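(* Let $d\ge2$, $1<\alpha<2$, and $1<q<d+\alpha$. For every $1<p<\infty$ there exists a constant $C_{d,p,q,\alpha}$ such that for every measurable $b:\mathbb R^{d+1}\to\mathbb R^d$ with $|b|^{\frac1{\alpha-1}}\in E_q$ and every $f\in C_c(\mathbb R^{d+1})$, $$\int_{\mathbb R^{d+1}}|b|\,\big|P_{(1-\frac1\alpha)\frac2p}f\big|^p\,dt\,dx\le C_{d,p,q,\alpha}^p\,\||b|^{\frac1{\alpha-1}}\|_{E_q}^{\alpha-1}\,\|f\|_{L^p(\mathbb R^{d+1})}^p,$$ $$\int_{\mathbb R^{d+1}}|b|\,\big|P^\ast_{(1-\frac1\alpha)\frac2p}f\big|^p\,dt\,dx\le C_{d,p,q,\alpha}^p\,\||b|^{\frac1{\alpha-1}}\|_{E_q}^{\alpha-1}\,\|f\|_{L^p(\mathbb R^{d+1})}^p.$$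
   Context: Points of $\mathbb R^{d+1}$ are written $(t,x)$, $t\in\mathbb R$, $x\in\mathbb R^d$. For $q>1$, $v\in L^q_{\rm loc}(\mathbb R^{d+1})$ is in the Morrey class $E_q$ if $$\|v\|_{E_q}:=\sup_{\rho>0,(t,x)\in\mathbb R^{d+1}}\rho\Big(\frac1{|C_\rho(t,x)|}\int_{C_\rho(t,x)}|v(s,y)|^q\,ds\,dy\Big)^{1/q}<\infty,\quad C_\rho(t,x)=\{(s,y):t\le s\le t+\rho^\alpha,\ |y-x|\le\rho\}.$$ For $0<\gamma\le2$, $$p_\gamma(t,x):=\mathbf 1_{\{t>0\}}\begin{cases}t^{\frac\gamma2}|x|^{-d-\alpha},&|x|\ge t^{\frac1\alpha},\\ t^{\frac\gamma2-\frac{d+\alpha}\alpha},&|x|<t^{\frac1\alpha},\end{cases}$$ and for $f\in C_c(\mathbb R^{d+1})$, $$P_\gamma f(t,x):=\int_{\mathbb R^{d+1}}p_\gamma(s,y)f(t+s,x+y)\,dy\,ds,\qquad P_\gamma^\ast f(t,x):=\int_{\mathbb R^{d+1}}p_\gamma(s,y)f(t-s,x+y)\,dy\,ds.$$ *)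

theory Defs
  imports "HOL-Analysis.Analysis"
begin

text \<open>
  A point \<open>(t, x)\<close> of space-time is an element of \<open>real \<times> (real ^ 'n)\<close>, with \<open>d = CARD('n)\<close>.
  All measurability and integration refers to the (complete) Lebesgue measure.
\<close>

definition parabolic_cylinder ::
    "real \<Rightarrow> real \<Rightarrow> real \<times> (real ^ 'n) \<Rightarrow> (real \<times> (real ^ 'n)) set" where
  "parabolic_cylinder \<alpha> \<rho> = (\<lambda>(t, x). {(s, y). t \<le> s \<and> s \<le> t + \<rho> powr \<alpha> \<and> norm (y - x) \<le> \<rho>})"

definition Lq_loc :: "real \<Rightarrow> ('a::euclidean_space \<Rightarrow> real) set" where
  "Lq_loc q = {v. v \<in> borel_measurable lebesgue \<and>
     (\<forall>K. compact K \<longrightarrow> set_integrable lebesgue K (\<lambda>z. \<bar>v z\<bar> powr q))}"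

text \<open>
  The inner integrals are Bochner integrals, so the value is meaningful only for
  \<open>v \<in> Lq_loc q\<close>. The supremum is taken in the extended nonnegative reals.
\<close>

definition morrey_norm :: "real \<Rightarrow> real \<Rightarrow> (real \<times> (real ^ 'n) \<Rightarrow> real) \<Rightarrow> ennreal" where
  "morrey_norm \<alpha> q v =
     (SUP \<rho>\<in>{0<..}. SUP z.
        ennreal (\<rho> * (1 / measure lebesgue (parabolic_cylinder \<alpha> \<rho> z) *
          (LINT w:parabolic_cylinder \<alpha> \<rho> z|lebesgue. \<bar>v w\<bar> powr q)) powr (1 / q)))"

definition morrey_class :: "real \<Rightarrow> real \<Rightarrow> (real \<times> (real ^ 'n) \<Rightarrow> real) set" where
  "morrey_class \<alpha> q = {v \<in> Lq_loc q. morrey_norm \<alpha> q v < \<infinity>}"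

definition p_kernel :: "real \<Rightarrow> real \<Rightarrow> real \<Rightarrow> real ^ 'n \<Rightarrow> real" where
  "p_kernel \<alpha> \<gamma> t x =
     (if t > 0 then
        (if norm x \<ge> t powr (1 / \<alpha>)
         then t powr (\<gamma> / 2) * norm x powr (- real CARD('n) - \<alpha>)
         else t powr (\<gamma> / 2 - (real CARD('n) + \<alpha>) / \<alpha>))
      else 0)"

definition P_op ::
    "real \<Rightarrow> real \<Rightarrow> (real \<times> (real ^ 'n) \<Rightarrow> real) \<Rightarrow> real \<times> (real ^ 'n) \<Rightarrow> real" where
  "P_op \<alpha> \<gamma> f = (\<lambda>(t, x). LINT (s, y)|lebesgue. p_kernel \<alpha> \<gamma> s y * f (t + s, x + y))"

definition P_adj_op ::
    "real \<Rightarrow> real \<Rightarrow> (real \<times> (real ^ 'n) \<Rightarrow> real) \<Rightarrow> real \<times> (real ^ 'n) \<Rightarrow> real" where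
  "P_adj_op \<alpha> \<gamma> f = (\<lambda>(t, x). LINT (s, y)|lebesgue. p_kernel \<alpha> \<gamma> s y * f (t - s, x + y))"

definition C_c :: "('a::euclidean_space \<Rightarrow> real) set" where
  "C_c = {f. continuous_on UNIV f \<and> compact (closure {z. f z \<noteq> 0})}"

definition Lp_norm :: "real \<Rightarrow> ('a::euclidean_space \<Rightarrow> real) \<Rightarrow> real" where
  "Lp_norm p f = (LINT z|lebesgue. \<bar>f z\<bar> powr p) powr (1 / p)"

end

theory Submission
  imports Defs
begin

text \<open>
  Put \<open>\<beta> = (\<alpha> - 1) / p\<close>, \<open>Q = d + \<alpha>\<close>, \<open>r = q / (\<alpha> - 1)\<close> and \<open>w = |b|\<close>. Both operators are dominated by the
  parabolic Riesz potential \<open>I\<^sub>\<beta>\<close> of order \<open>\<beta>\<close>, so the claim is a trace inequality for \<open>I\<^sub>\<beta>\<close> under the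
  Morrey condition that the integrals of \<open>w powr r\<close> over parabolic balls are at most
  \<open>A powr r * R powr (Q - \<beta> p r)\<close>.

  It follows from Schur's test, with powers of an explicit weight as test functions. For small
  \<open>\<kappa> > 0\<close> the potential \<open>U = I\<^sub>\<kappa> (w powr r)\<close> is a Muckenhoupt \<open>A\<^sub>1\<close> weight which again satisfies a Morrey
  bound, and it controls the averages of \<open>w powr r\<close> at its centre. Hence, with
  \<open>h = (U / A powr r) powr (1 / (\<beta> p r - \<kappa>))\<close> and small \<open>\<delta> > 0\<close>, splitting the potentials at the
  radius \<open>1 / h x\<close> gives
  \<open>I\<^sub>\<beta> (h powr (\<beta> + \<delta>)) \<le> C h powr \<delta>\<close> and
  \<open>I\<^sub>\<beta> (w h powr (\<delta> (p - 1))) \<le> C A h powr ((\<beta> + \<delta>) (p - 1))\<close>.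
\<close>

section \<open>Weighted integrals\<close>

text \<open>Schur's test with powers of \<open>w\<close> itself need not close, because averages of
  \<open>w\<close> around a point need not be controlled by its value there. Passing to
  \<open>U\<close> repairs this at the cost of \<kappa>. The exponent of \<open>h\<close> is forced
  by scaling: the Morrey bound makes \<open>w powr r / A powr r\<close> behave like a length to the
  power \<open>- \<beta> p r\<close>, and a potential of order \<kappa> adds \<kappa>, so
  \<open>h\<close> is an inverse length. Both Schur bounds are then dimensionally consistent, and
  \<open>A\<close> enters only through the second, linearly. Below the radius \<open>1 / h x\<close>
  the centre value of \<open>U\<close> is the better bound, above it the Morrey bound is; the radial
  integral converges when \<open>R h\<close> has a positive power at small radii and a negative one
  at large radii. In the second estimate \<open>r > 1\<close> lets Hoelder separate \<open>w\<close>
  from the power of \<open>h\<close>. This leaves the exponent \<open>\<beta> - \<kappa> / r\<close>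
  at small radii, so \<kappa> must stay below \<open>\<beta> r\<close>. A small \<delta> keeps all
  powers of \<open>h\<close> below \<open>\<beta> p r - \<kappa>\<close>, the power whose averages
  are known.\<close>

lemma nn_integral_weighted_Holder_pos:
  fixes K :: "'a \<Rightarrow> ennreal" and f g :: "'a \<Rightarrow> real"
  assumes [measurable]: "K \<in> borel_measurable M" "f \<in> borel_measurable M" "g \<in> borel_measurable M"
    and f0: "\<And>x. 0 \<le> f x" and g0: "\<And>x. 0 \<le> g x"
    and pq: "p > 1" "q > 1" "1 / p + 1 / q = 1" and A: "A > 0" and B: "B > 0"
    and fA: "(\<integral>\<^sup>+x. K x * ennreal (f x powr p) \<partial>M) \<le> ennreal A"
    and gB: "(\<integral>\<^sup>+x. K x * ennreal (g x powr q) \<partial>M) \<le> ennreal B"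
  shows "(\<integral>\<^sup>+x. K x * ennreal (f x * g x) \<partial>M) \<le> ennreal (A powr (1/p) * B powr (1/q))"
proof -
  define a b where "a = A powr (1/p)" and "b = B powr (1/q)"
  have ab: "a > 0" "b > 0" "a powr p = A" "b powr q = B"
    using A B pq by (auto simp: a_def b_def powr_powr)
  \<comment> \<open>Young's inequality for \<open>f x / a\<close> and \<open>g x / b\<close>, scaled
    back by \<open>a * b\<close>; this normalisation requires positive \<open>A\<close> and
    \<open>B\<close>. The weight \<open>K\<close> is \<open>ennreal\<close>-valued because
    \<open>kern\<close> is infinite at \<open>0\<close>.\<close>
  have young: "f x * g x \<le> a * b / (p * A) * f x powr p + a * b / (q * B) * g x powr q" for x
  proof -
    have "(f x / a) * (g x / b) \<le> (f x / a) powr p / p + (g x / b) powr q / q"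
      using f0 g0 ab pq by (intro Youngs_inequality) auto
    also have "\<dots> = f x powr p / (p * A) + g x powr q / (q * B)"
      using ab f0[of x] g0[of x] by (simp add: powr_divide mult.commute)
    finally have "f x * g x \<le> (a * b) * (f x powr p / (p * A) + g x powr q / (q * B))"
      using ab by (simp add: field_simps)
    then show ?thesis by (simp add: algebra_simps)
  qed
  have "(\<integral>\<^sup>+x. K x * ennreal (f x * g x) \<partial>M)
      \<le> (\<integral>\<^sup>+x. ennreal (a * b / (p * A)) * (K x * ennreal (f x powr p))
              + ennreal (a * b / (q * B)) * (K x * ennreal (g x powr q)) \<partial>M)"
  proof (rule nn_integral_mono)
    fix x
    have "K x * ennreal (f x * g x)
        \<le> K x * ennreal (a * b / (p * A) * f x powr p + a * b / (q * B) * g x powr q)"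
      using young by (intro mult_left_mono ennreal_leI) auto
    also have "\<dots> = ennreal (a * b / (p * A)) * (K x * ennreal (f x powr p))
              + ennreal (a * b / (q * B)) * (K x * ennreal (g x powr q))"
    proof -
      have "ennreal (a * b / (p * A) * f x powr p + a * b / (q * B) * g x powr q)
          = ennreal (a * b / (p * A)) * ennreal (f x powr p) + ennreal (a * b / (q * B)) * ennreal (g x powr q)"
      proof -
        have "0 \<le> a * b / (p * A)" "0 \<le> a * b / (q * B)"
          using ab pq A B by simp_all
        then show ?thesis
          by (simp only: ennreal_plus ennreal_mult mult_nonneg_nonneg powr_ge_zero)
      qed
      then show ?thesis by (simp only: distrib_left mult.left_commute[of "K x"])
    qed
    finally show "K x * ennreal (f x * g x) \<le> \<dots>" .
  qed
  also have "\<dots> = ennreal (a * b / (p * A)) * (\<integral>\<^sup>+x. K x * ennreal (f x powr p) \<partial>M)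
      + ennreal (a * b / (q * B)) * (\<integral>\<^sup>+x. K x * ennreal (g x powr q) \<partial>M)"
    by (simp add: nn_integral_add nn_integral_cmult)
  also have "\<dots> \<le> ennreal (a * b / (p * A)) * ennreal A + ennreal (a * b / (q * B)) * ennreal B"
    using fA gB by (intro add_mono mult_left_mono) auto
  also have "\<dots> = ennreal (a * b * (1 / p + 1 / q))"
    using ab pq(1,2) A B by (simp add: ennreal_mult[symmetric] ennreal_plus[symmetric] distrib_left del: ennreal_plus)
  finally show ?thesis using pq by (simp add: a_def b_def)
qed

text \<open>Vanishing \<open>A\<close> or \<open>B\<close> is reached by applying the positive case
  to \<open>A + 1 / Suc n\<close> and \<open>B + 1 / Suc n\<close> and letting \<open>n\<close>
  grow.\<close>

lemma nn_integral_weighted_Holder: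
  fixes K :: "'a \<Rightarrow> ennreal" and f g :: "'a \<Rightarrow> real"
  assumes meas: "K \<in> borel_measurable M" "f \<in> borel_measurable M" "g \<in> borel_measurable M"
    and nn: "\<And>x. 0 \<le> f x" "\<And>x. 0 \<le> g x"
    and pq: "p > 1" "q > 1" "1 / p + 1 / q = 1" and A: "A \<ge> 0" and B: "B \<ge> 0"
    and fA: "(\<integral>\<^sup>+x. K x * ennreal (f x powr p) \<partial>M) \<le> ennreal A"
    and gB: "(\<integral>\<^sup>+x. K x * ennreal (g x powr q) \<partial>M) \<le> ennreal B"
  shows "(\<integral>\<^sup>+x. K x * ennreal (f x * g x) \<partial>M) \<le> ennreal (A powr (1/p) * B powr (1/q))"
proof (rule LIMSEQ_le_const)
  have "(\<lambda>n. A + 1 / real (Suc n)) \<longlonglongrightarrow> A + 0" "(\<lambda>n. B + 1 / real (Suc n)) \<longlonglongrightarrow> B + 0"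
    by (intro tendsto_intros LIMSEQ_Suc[OF lim_1_over_n])+
  then have "(\<lambda>n. (A + 1 / real (Suc n)) powr (1/p)) \<longlonglongrightarrow> A powr (1/p)"
    "(\<lambda>n. (B + 1 / real (Suc n)) powr (1/q)) \<longlonglongrightarrow> B powr (1/q)"
    using A B pq by (auto intro!: tendsto_powr' always_eventually)
  then show "(\<lambda>n. ennreal ((A + 1 / real (Suc n)) powr (1/p) * (B + 1 / real (Suc n)) powr (1/q)))
      \<longlonglongrightarrow> ennreal (A powr (1/p) * B powr (1/q))"
    by (intro tendsto_ennrealI tendsto_mult)
  have "(\<integral>\<^sup>+x. K x * ennreal (f x * g x) \<partial>M)
      \<le> ennreal ((A + 1 / real (Suc n)) powr (1/p) * (B + 1 / real (Suc n)) powr (1/q))" for n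
    using A B by (intro nn_integral_weighted_Holder_pos[OF meas nn pq] order_trans[OF fA]
        order_trans[OF gB] ennreal_leI add_nonneg_pos) auto
  then show "\<exists>N. \<forall>n\<ge>N. (\<integral>\<^sup>+x. K x * ennreal (f x * g x) \<partial>M)
      \<le> ennreal ((A + 1 / real (Suc n)) powr (1/p) * (B + 1 / real (Suc n)) powr (1/q))"
    by blast
qed

section \<open>Power integrals on the half-line and translation of Lebesgue measure\<close>

lemma nn_integral_powr_from_0:
  assumes "a > 0" "r \<ge> 0"
  shows "(\<integral>\<^sup>+R. indicator {0..r} R * ennreal (R powr (a - 1)) \<partial>lborel) = ennreal (r powr a / a)"
  using nn_integral_has_integral_lebesgue'[OF _ has_integral_powr_from_0[of "a - 1" r]] assms
  by (simp add: mult.commute)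

lemma nn_integral_powr_to_inf:
  assumes "b > 0" "r > 0"
  shows "(\<integral>\<^sup>+R. indicator {r..} R * ennreal (R powr (- b - 1)) \<partial>lborel) = ennreal (r powr - b / b)"
  using nn_integral_has_integral_lebesgue'[OF _ has_integral_powr_to_inf[of "- b - 1" r]] assms
  by (simp add: mult.commute)

text \<open>Cut at \<open>R = 1 / h\<close>. The measure \<open>dR / R\<close> is invariant under
  dilation, so the bound is independent of \<open>h\<close>; \<open>a > 0\<close> gives convergence
  at the origin and \<open>b > 0\<close> at infinity. The splitting of potentials at a critical
  radius is reduced to this integral.\<close>

lemma nn_integral_min_powr:
  assumes a: "a > 0" and b: "b > 0" and h: "h > 0"
  shows "(\<integral>\<^sup>+R. indicator {0<..} R * ennreal (R powr -1 * min ((R * h) powr a) ((R * h) powr - b)) \<partial>lborel)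
    \<le> ennreal (1 / a + 1 / b)"
proof -
  have "(\<integral>\<^sup>+R. indicator {0<..} R * ennreal (R powr -1 * min ((R * h) powr a) ((R * h) powr - b)) \<partial>lborel)
     \<le> (\<integral>\<^sup>+R. ennreal (h powr a) * (indicator {0..1/h} R * ennreal (R powr (a - 1)))
          + ennreal (h powr - b) * (indicator {1/h..} R * ennreal (R powr (- b - 1))) \<partial>lborel)"
  proof (rule nn_integral_mono)
    fix R :: real
    consider "R \<le> 0" | "0 < R" "R \<le> 1/h" | "R > 1/h" "R > 0" by linarith
    then show "indicator {0<..} R * ennreal (R powr -1 * min ((R * h) powr a) ((R * h) powr - b))
      \<le> ennreal (h powr a) * (indicator {0..1/h} R * ennreal (R powr (a - 1)))
          + ennreal (h powr - b) * (indicator {1/h..} R * ennreal (R powr (- b - 1)))"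
    proof cases
      case 2
      have "R powr -1 * min ((R * h) powr a) ((R * h) powr - b) \<le> R powr -1 * (R * h) powr a"
        by (intro mult_left_mono) auto
      also have "\<dots> = h powr a * R powr (a - 1)"
        using 2 h by (simp add: powr_mult powr_diff powr_minus field_simps)
      finally have "ennreal (R powr -1 * min ((R * h) powr a) ((R * h) powr - b))
          \<le> ennreal (h powr a) * ennreal (R powr (a - 1))"
        by (simp add: ennreal_mult[symmetric] ennreal_leI)
      then show ?thesis using 2 by (simp add: add_increasing2)
    next
      case 3
      have "R powr -1 * min ((R * h) powr a) ((R * h) powr - b) \<le> R powr -1 * (R * h) powr - b"
        by (intro mult_left_mono) auto
      also have "\<dots> = h powr - b * R powr (- b - 1)"
        using 3 h by (simp add: powr_mult powr_diff powr_minus field_simps)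
      finally have "ennreal (R powr -1 * min ((R * h) powr a) ((R * h) powr - b))
          \<le> ennreal (h powr - b) * ennreal (R powr (- b - 1))"
        by (simp add: ennreal_mult[symmetric] ennreal_leI)
      then show ?thesis using 3 by (simp add: add_increasing)
    qed auto
  qed
  also have "\<dots> = ennreal (h powr a) * ennreal ((1/h) powr a / a)
      + ennreal (h powr - b) * ennreal ((1/h) powr - b / b)"
    using h a b by (simp add: nn_integral_add nn_integral_cmult nn_integral_powr_from_0 nn_integral_powr_to_inf)
  also have "\<dots> = ennreal (1 / a + 1 / b)"
    using h a b by (simp add: ennreal_mult[symmetric] powr_divide powr_minus ennreal_plus)
  finally show ?thesis .
qed

lemma nn_integral_lborel_shift:
  fixes c :: "'a::euclidean_space"
  assumes [measurable]: "F \<in> borel_measurable borel"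
  shows "(\<integral>\<^sup>+y. F (c + y) \<partial>lborel) = (\<integral>\<^sup>+y. F y \<partial>lborel)"
proof -
  have "(\<integral>\<^sup>+y. F y \<partial>lborel) = (\<integral>\<^sup>+y. F y \<partial>distr lborel borel ((+) c))"
    by (simp add: lborel_distr_plus)
  also have "\<dots> = (\<integral>\<^sup>+y. F (c + y) \<partial>lborel)"
    by (subst nn_integral_distr) auto
  finally show ?thesis by simp
qed

section \<open>Potentials on a space with a homogeneous norm\<close>

text \<open>The parabolic geometry enters only through the triangle inequality, symmetry and volume
  growth from above. Symmetry makes the kernel self-adjoint in Schur's test;
  \<open>unit_ball_pos\<close> makes the potential behind the weight positive at every
  point.\<close>

locale homogeneous_norm =
  fixes N :: "'a::euclidean_space \<Rightarrow> real" and Q c :: real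
  assumes N_measurable [measurable]: "N \<in> borel_measurable borel"
    and N_nonneg: "0 \<le> N x"
    and N_minus: "N (- x) = N x"
    and N_triangle: "N (x + y) \<le> N x + N y"
    and Q_pos: "Q > 0" and c_pos: "c > 0"
    and unit_ball_pos: "emeasure lborel {x. N x < 1} > 0"
    and ball_volume: "R > 0 \<Longrightarrow> emeasure lborel {x. N x < R} \<le> ennreal (c * R powr Q)"
begin

definition ball_integral :: "real \<Rightarrow> 'a \<Rightarrow> ('a \<Rightarrow> ennreal) \<Rightarrow> ennreal" where
  "ball_integral R x g = (\<integral>\<^sup>+y. indicator {..<R} (N (y - x)) * g y \<partial>lborel)"

text \<open>The Riesz potential with kernel \<open>N (y - x) powr (\<beta> - Q) / (Q - \<beta>)\<close>, written in layer-cake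
  form, so that it only sees the integrals of \<open>g\<close> over balls.\<close>

definition potential :: "real \<Rightarrow> ('a \<Rightarrow> ennreal) \<Rightarrow> 'a \<Rightarrow> ennreal" where
  "potential \<beta> g x =
     (\<integral>\<^sup>+R. indicator {0<..} R * ennreal (R powr (\<beta> - Q - 1)) * ball_integral R x g \<partial>lborel)"

lemma N_commute: "N (x - y) = N (y - x)"
  using N_minus[of "x - y"] by simp

lemma N_triangle_diff: "N (x - z) \<le> N (x - y) + N (y - z)"
  using N_triangle[of "x - y" "y - z"] by simp

lemma ball_integral_measurable [measurable]:
  assumes [measurable]: "g \<in> borel_measurable borel" "F \<in> borel_measurable M" "G \<in> borel_measurable M"
  shows "(\<lambda>z. ball_integral (F z) (G z) g) \<in> borel_measurable M"
proof -
  have [measurable]: "g \<in> borel_measurable lborel" "N \<in> borel_measurable lborel"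
    using assms by simp_all
  have "ball_integral (F z) (G z) g = (\<integral>\<^sup>+y. (if N (y - G z) < F z then 1 else 0) * g y \<partial>lborel)" for z
    unfolding ball_integral_def by (intro nn_integral_cong) (simp add: indicator_def)
  then show ?thesis by simp
qed

lemma potential_measurable [measurable]:
  assumes [measurable]: "g \<in> borel_measurable borel" "G \<in> borel_measurable M"
  shows "(\<lambda>z. potential \<beta> g (G z)) \<in> borel_measurable M"
  unfolding potential_def by measurable

section \<open>Volume and Tonelli estimates for ball integrals\<close>

lemma ball_integral_one:
  assumes "R > 0"
  shows "ball_integral R x (\<lambda>_. 1) \<le> ennreal (c * R powr Q)"
proof -
  have "ball_integral R x (\<lambda>_. 1) = (\<integral>\<^sup>+y. indicator {..<R} (N (- x + y)) \<partial>lborel)"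
    by (simp add: ball_integral_def)
  also have "\<dots> = (\<integral>\<^sup>+y. indicator {..<R} (N y) \<partial>lborel)"
    by (rule nn_integral_lborel_shift) measurable
  also have "\<dots> = (\<integral>\<^sup>+y. indicator {y. N y < R} y \<partial>lborel)"
    by (intro nn_integral_cong) (auto simp: indicator_def)
  also have "\<dots> = emeasure lborel {y. N y < R}"
    by (rule nn_integral_indicator) measurable
  finally show ?thesis using ball_volume[OF assms] by simp
qed

lemma ball_integral_mono_radius: "R \<le> S \<Longrightarrow> ball_integral R x g \<le> ball_integral S x g"
  unfolding ball_integral_def by (intro nn_integral_mono mult_right_mono) (auto simp: indicator_def)

lemma ball_integral_mono: "(\<And>y. f y \<le> g y) \<Longrightarrow> ball_integral R x f \<le> ball_integral R x g"
  unfolding ball_integral_def by (intro nn_integral_mono mult_left_mono) auto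

lemma ball_integral_cmult:
  "g \<in> borel_measurable borel \<Longrightarrow> ball_integral R x (\<lambda>y. a * g y) = a * ball_integral R x g"
  unfolding ball_integral_def by (simp add: mult.left_commute[of _ a] nn_integral_cmult)

text \<open>After Tonelli, each \<open>z\<close> is counted with the volume of the set of
  \<open>y\<close> within \<open>R\<close> of \<open>x\<close> and within \<open>S\<close> of
  \<open>z\<close>. That volume is at most the one of the smaller ball, and the set is empty unless
  \<open>z\<close> lies within \<open>R + S\<close> of \<open>x\<close>.\<close>

lemma ball_integral_ball_integral:
  assumes [measurable]: "v \<in> borel_measurable borel" and R: "R > 0" and S: "S > 0"
  shows "ball_integral R x (\<lambda>y. ball_integral S y v)
    \<le> ennreal (c * min R S powr Q) * ball_integral (R + S) x v"
proof -
  have "ball_integral R x (\<lambda>y. ball_integral S y v)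
      = (\<integral>\<^sup>+y. \<integral>\<^sup>+z. indicator {..<R} (N (y - x)) * (indicator {..<S} (N (z - y)) * v z) \<partial>lborel \<partial>lborel)"
    unfolding ball_integral_def by (intro nn_integral_cong nn_integral_cmult[symmetric]) measurable
  also have "\<dots> = (\<integral>\<^sup>+z. \<integral>\<^sup>+y. indicator {..<R} (N (y - x)) * (indicator {..<S} (N (z - y)) * v z) \<partial>lborel \<partial>lborel)"
    by (rule lborel_pair.Fubini'[symmetric]) measurable
  also have "\<dots> \<le> (\<integral>\<^sup>+z. ennreal (c * min R S powr Q) * (indicator {..<R + S} (N (z - x)) * v z) \<partial>lborel)"
  proof (rule nn_integral_mono)
    fix z
    let ?I = "\<integral>\<^sup>+y. indicator {..<R} (N (y - x)) * indicator {..<S} (N (z - y)) \<partial>lborel"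
    have "?I \<le> ball_integral R x (\<lambda>_. 1)" "?I \<le> ball_integral S z (\<lambda>_. 1)"
      unfolding ball_integral_def by (intro nn_integral_mono; simp add: indicator_def N_commute[of z])+
    then have I: "?I \<le> ennreal (c * min R S powr Q)"
      using ball_integral_one[OF R, of x] ball_integral_one[OF S, of z] by (auto simp: min_def intro: order_trans)
    have "(\<integral>\<^sup>+y. indicator {..<R} (N (y - x)) * (indicator {..<S} (N (z - y)) * v z) \<partial>lborel)
      \<le> (\<integral>\<^sup>+y. indicator {..<R} (N (y - x)) * indicator {..<S} (N (z - y)) * (indicator {..<R + S} (N (z - x)) * v z) \<partial>lborel)"
    proof (intro nn_integral_mono)
      fix y
      show "indicator {..<R} (N (y - x)) * (indicator {..<S} (N (z - y)) * v z)
        \<le> indicator {..<R} (N (y - x)) * indicator {..<S} (N (z - y)) * (indicator {..<R + S} (N (z - x)) * v z)"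
        using N_triangle_diff[of z x y] by (auto simp: indicator_def)
    qed
    also have "\<dots> = ?I * (indicator {..<R + S} (N (z - x)) * v z)"
      by (subst nn_integral_multc) auto
    also have "\<dots> \<le> ennreal (c * min R S powr Q) * (indicator {..<R + S} (N (z - x)) * v z)"
      by (intro mult_right_mono I) auto
    finally show "(\<integral>\<^sup>+y. indicator {..<R} (N (y - x)) * (indicator {..<S} (N (z - y)) * v z) \<partial>lborel) \<le> \<dots>" .
  qed
  also have "\<dots> = ennreal (c * min R S powr Q) * ball_integral (R + S) x v"
    unfolding ball_integral_def by (rule nn_integral_cmult) measurable
  finally show ?thesis .
qed

section \<open>Integrals of potentials over balls\<close>

lemma ball_integral_potential:
  assumes [measurable]: "v \<in> borel_measurable borel" and R: "R > 0"
  shows "ball_integral R x (potential \<beta> v)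
    \<le> (\<integral>\<^sup>+S. indicator {0<..} S * ennreal (S powr (\<beta> - Q - 1)) *
          (ennreal (c * min R S powr Q) * ball_integral (R + S) x v) \<partial>lborel)"
proof -
  have "ball_integral R x (potential \<beta> v)
      = (\<integral>\<^sup>+y. \<integral>\<^sup>+S. indicator {..<R} (N (y - x)) *
            (indicator {0<..} S * ennreal (S powr (\<beta> - Q - 1)) * ball_integral S y v) \<partial>lborel \<partial>lborel)"
    unfolding potential_def ball_integral_def[of R]
    by (intro nn_integral_cong nn_integral_cmult[symmetric]) measurable
  also have "\<dots> = (\<integral>\<^sup>+S. \<integral>\<^sup>+y. indicator {..<R} (N (y - x)) *
            (indicator {0<..} S * ennreal (S powr (\<beta> - Q - 1)) * ball_integral S y v) \<partial>lborel \<partial>lborel)"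
    by (rule lborel_pair.Fubini'[symmetric]) measurable
  also have "\<dots> = (\<integral>\<^sup>+S. indicator {0<..} S * ennreal (S powr (\<beta> - Q - 1)) *
            ball_integral R x (\<lambda>y. ball_integral S y v) \<partial>lborel)"
    unfolding ball_integral_def[of R] mult.left_commute[of "indicator {..<R} _"]
    by (intro nn_integral_cong nn_integral_cmult) measurable
  also have "\<dots> \<le> (\<integral>\<^sup>+S. indicator {0<..} S * ennreal (S powr (\<beta> - Q - 1)) *
          (ennreal (c * min R S powr Q) * ball_integral (R + S) x v) \<partial>lborel)"
    using R by (intro nn_integral_mono) (auto simp: indicator_def intro!: mult_left_mono ball_integral_ball_integral)
  finally show ?thesis .
qed

text \<open>A potential of order \<kappa> improves the Morrey exponent by \<kappa>. With
  \<open>R + S \<le> 2 * max R S\<close>, layers \<open>S \<le> R\<close> contribute like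
  \<open>S powr (\<kappa> - 1)\<close>, integrable at \<open>0\<close>, and layers
  \<open>S > R\<close> like \<open>S powr (\<kappa> - \<mu> - 1)\<close>, integrable at infinity
  since \<open>\<kappa> < \<mu>\<close>. Replacing \<open>R + S\<close> by the larger radius uses
  \<open>\<mu> \<le> Q\<close>.\<close>

lemma ball_integral_potential_decay:
  assumes [measurable]: "v \<in> borel_measurable borel" and R: "R > 0"
    and \<kappa>: "0 < \<kappa>" "\<kappa> < \<mu>" "\<mu> \<le> Q" and D: "D \<ge> 0"
    and decay: "\<And>S. S > 0 \<Longrightarrow> ball_integral S x v \<le> ennreal (D * S powr (Q - \<mu>))"
  shows "ball_integral R x (potential \<kappa> v)
    \<le> ennreal (c * 2 powr (Q - \<mu>) * (1 / \<kappa> + 1 / (\<mu> - \<kappa>)) * (D * R powr (Q + \<kappa> - \<mu>)))"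
proof -
  let ?C = "c * 2 powr (Q - \<mu>) * (D * R powr (Q + \<kappa> - \<mu>))"
  have C: "?C \<ge> 0" using c_pos D by simp
  have "ball_integral R x (potential \<kappa> v) \<le> (\<integral>\<^sup>+S. indicator {0<..} S * ennreal (S powr (\<kappa> - Q - 1)) *
          (ennreal (c * min R S powr Q) * ball_integral (R + S) x v) \<partial>lborel)"
    by (rule ball_integral_potential) (use R in auto)
  also have "\<dots> \<le> (\<integral>\<^sup>+S. ennreal ?C * (indicator {0<..} S *
      ennreal (S powr -1 * min ((S * (1 / R)) powr \<kappa>) ((S * (1 / R)) powr - (\<mu> - \<kappa>)))) \<partial>lborel)"
  proof (rule nn_integral_mono)
    fix S :: real
    show "indicator {0<..} S * ennreal (S powr (\<kappa> - Q - 1)) *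
          (ennreal (c * min R S powr Q) * ball_integral (R + S) x v)
      \<le> ennreal ?C * (indicator {0<..} S *
          ennreal (S powr -1 * min ((S * (1 / R)) powr \<kappa>) ((S * (1 / R)) powr - (\<mu> - \<kappa>))))"
    proof (cases "S > 0")
      case S: True
      have *: "S powr (\<kappa> - Q - 1) * (c * min R S powr Q * (D * (R + S) powr (Q - \<mu>)))
        \<le> ?C * (S powr -1 * min ((S * (1 / R)) powr \<kappa>) ((S * (1 / R)) powr - (\<mu> - \<kappa>)))"
      proof -
        have "S powr (\<kappa> - Q - 1) * (c * min R S powr Q * (D * (R + S) powr (Q - \<mu>)))
          \<le> S powr (\<kappa> - Q - 1) * (c * min R S powr Q * (D * (2 * max R S) powr (Q - \<mu>)))"
          using R S \<kappa> D c_pos by (intro mult_left_mono powr_mono2) auto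
        also have "\<dots> \<le> ?C * (S powr -1 * min ((S * (1 / R)) powr \<kappa>) ((S * (1 / R)) powr - (\<mu> - \<kappa>)))"
        proof (cases "S \<le> R")
          case True
          have "(S * (1 / R)) powr \<kappa> \<le> (S * (1 / R)) powr - (\<mu> - \<kappa>)"
            using True R S \<kappa> by (intro powr_mono') auto
          then have "min ((S * (1 / R)) powr \<kappa>) ((S * (1 / R)) powr - (\<mu> - \<kappa>)) = (S / R) powr \<kappa>"
            by simp
          moreover have "S powr (\<kappa> - Q - 1) * S powr Q * R powr (Q - \<mu>)
              = R powr (Q + \<kappa> - \<mu>) * S powr -1 * (S / R) powr \<kappa>"
            using R S by (simp add: powr_def ln_div mult_exp_exp algebra_simps)
          moreover have "S powr (\<kappa> - Q - 1) * (c * min R S powr Q * (D * (2 * max R S) powr (Q - \<mu>)))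
              = c * 2 powr (Q - \<mu>) * D * (S powr (\<kappa> - Q - 1) * S powr Q * R powr (Q - \<mu>))"
            using True R S by (simp add: min_absorb2 max_absorb1 powr_mult mult_ac)
          ultimately show ?thesis
            by (simp only: mult.assoc order_refl times_divide_eq_right mult_1_right)
        next
          case False
          have "(S * (1 / R)) powr - (\<mu> - \<kappa>) \<le> (S * (1 / R)) powr \<kappa>"
            using False R S \<kappa> by (intro powr_mono) (auto simp: field_simps)
          then have "min ((S * (1 / R)) powr \<kappa>) ((S * (1 / R)) powr - (\<mu> - \<kappa>)) = (S / R) powr - (\<mu> - \<kappa>)"
            by simp
          moreover have "S powr (\<kappa> - Q - 1) * R powr Q * S powr (Q - \<mu>)
              = R powr (Q + \<kappa> - \<mu>) * S powr -1 * (S / R) powr - (\<mu> - \<kappa>)"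
            using R S by (simp add: powr_def ln_div mult_exp_exp algebra_simps)
          moreover have "S powr (\<kappa> - Q - 1) * (c * min R S powr Q * (D * (2 * max R S) powr (Q - \<mu>)))
              = c * 2 powr (Q - \<mu>) * D * (S powr (\<kappa> - Q - 1) * R powr Q * S powr (Q - \<mu>))"
            using False R S by (simp add: min_absorb1 max_absorb2 powr_mult mult_ac)
          ultimately show ?thesis
            by (simp only: mult.assoc order_refl times_divide_eq_right mult_1_right)
        qed
        finally show ?thesis .
      qed
      have "ennreal (S powr (\<kappa> - Q - 1)) * (ennreal (c * min R S powr Q) * ball_integral (R + S) x v)
        \<le> ennreal (S powr (\<kappa> - Q - 1)) * (ennreal (c * min R S powr Q) * ennreal (D * (R + S) powr (Q - \<mu>)))"
        using R S by (intro mult_left_mono decay) auto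
      also have "\<dots> = ennreal (S powr (\<kappa> - Q - 1) * (c * min R S powr Q * (D * (R + S) powr (Q - \<mu>))))"
        using c_pos D by (simp add: ennreal_mult[symmetric])
      also have "\<dots> \<le> ennreal (?C * (S powr -1 * min ((S * (1 / R)) powr \<kappa>) ((S * (1 / R)) powr - (\<mu> - \<kappa>))))"
        by (rule ennreal_leI[OF *])
      also have "\<dots> = ennreal ?C * ennreal (S powr -1 * min ((S * (1 / R)) powr \<kappa>) ((S * (1 / R)) powr - (\<mu> - \<kappa>)))"
        using C by (rule ennreal_mult) simp
      finally show ?thesis using S by simp
    qed simp
  qed
  also have "\<dots> = ennreal ?C * (\<integral>\<^sup>+S. indicator {0<..} S *
      ennreal (S powr -1 * min ((S * (1 / R)) powr \<kappa>) ((S * (1 / R)) powr - (\<mu> - \<kappa>))) \<partial>lborel)"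
    by (rule nn_integral_cmult) measurable
  also have "\<dots> \<le> ennreal ?C * ennreal (1 / \<kappa> + 1 / (\<mu> - \<kappa>))"
    by (intro mult_left_mono nn_integral_min_powr) (use R \<kappa> in auto)
  also have "\<dots> = ennreal (?C * (1 / \<kappa> + 1 / (\<mu> - \<kappa>)))"
    using C \<kappa> by (subst ennreal_mult) auto
  finally show ?thesis by (simp add: mult_ac)
qed

text \<open>Only the layers \<open>S \<ge> T\<close> are kept; on each of them the ball of radius
  \<open>S\<close> contains the one of radius \<open>T\<close>.\<close>

lemma potential_ge_ball_integral:
  assumes [measurable]: "v \<in> borel_measurable borel" and T: "T > 0" and \<kappa>: "\<kappa> < Q"
  shows "ennreal (T powr (\<kappa> - Q) / (Q - \<kappa>)) * ball_integral T x v \<le> potential \<kappa> v x"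
proof -
  have "ennreal (T powr (\<kappa> - Q) / (Q - \<kappa>)) * ball_integral T x v
    = (\<integral>\<^sup>+S. indicator {T..} S * ennreal (S powr (- (Q - \<kappa>) - 1)) * ball_integral T x v \<partial>lborel)"
    using nn_integral_powr_to_inf[of "Q - \<kappa>" T] T \<kappa> by (simp add: nn_integral_multc)
  also have "\<dots> \<le> potential \<kappa> v x"
    unfolding potential_def using T
    by (intro nn_integral_mono) (auto simp: indicator_def intro!: mult_left_mono ball_integral_mono_radius)
  finally show ?thesis .
qed

lemma ball_integral_le_potential:
  assumes [measurable]: "v \<in> borel_measurable borel" and T: "T > 0" and \<kappa>: "\<kappa> < Q"
  shows "ball_integral T x v \<le> ennreal ((Q - \<kappa>) * T powr (Q - \<kappa>)) * potential \<kappa> v x"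
proof -
  have "ball_integral T x v = ennreal ((Q - \<kappa>) * T powr (Q - \<kappa>)) *
      (ennreal (T powr (\<kappa> - Q) / (Q - \<kappa>)) * ball_integral T x v)"
  proof -
    have "(Q - \<kappa>) * T powr (Q - \<kappa>) * (T powr (\<kappa> - Q) / (Q - \<kappa>)) = 1"
      using T \<kappa> by (simp add: powr_add[symmetric])
    then have "ennreal ((Q - \<kappa>) * T powr (Q - \<kappa>)) * ennreal (T powr (\<kappa> - Q) / (Q - \<kappa>)) = 1"
      using \<kappa> by (subst ennreal_mult[symmetric]) auto
    then show ?thesis by (simp add: mult.assoc[symmetric])
  qed
  also have "\<dots> \<le> ennreal ((Q - \<kappa>) * T powr (Q - \<kappa>)) * potential \<kappa> v x"
    by (intro mult_left_mono potential_ge_ball_integral) (use T \<kappa> in auto)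
  finally show ?thesis .
qed

text \<open>Potentials are Muckenhoupt \<open>A\<^sub>1\<close> weights.\<close>

lemma ball_integral_potential_le_potential:
  assumes [measurable]: "v \<in> borel_measurable borel" and R: "R > 0" and \<kappa>: "0 < \<kappa>" "\<kappa> < Q"
  shows "ball_integral R x (potential \<kappa> v)
    \<le> ennreal (c * 2 powr (Q - \<kappa>) * ((Q - \<kappa>) / \<kappa> + 1) * R powr Q) * potential \<kappa> v x"
proof -
  let ?k = "\<lambda>S. ennreal (S powr (\<kappa> - Q - 1))"
  have "ball_integral R x (potential \<kappa> v) \<le> (\<integral>\<^sup>+S. indicator {0<..} S * ?k S *
          (ennreal (c * min R S powr Q) * ball_integral (R + S) x v) \<partial>lborel)"
    by (rule ball_integral_potential) (use R in auto)
  \<comment> \<open>For layers \<open>S \<le> R\<close> the enlarged ball lies in the fixed ball of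
    radius \<open>2 * R\<close>. For \<open>S > R\<close> it lies in the ball of radius
    \<open>2 * S\<close>, and the layers can be compared one by one with those of the
    potential.\<close>
  also have "\<dots> \<le> (\<integral>\<^sup>+S. indicator {0..R} S * ennreal (S powr (\<kappa> - 1)) * (ennreal c * ball_integral (2 * R) x v)
        + ennreal (c * R powr Q) * (indicator {0<..} S * ?k S * ball_integral (2 * S) x v) \<partial>lborel)"
  proof (rule nn_integral_mono)
    fix S :: real
    consider "S \<le> 0" | "0 < S" "S \<le> R" | "S > R" "S > 0" by linarith
    then show "indicator {0<..} S * ?k S * (ennreal (c * min R S powr Q) * ball_integral (R + S) x v)
      \<le> indicator {0..R} S * ennreal (S powr (\<kappa> - 1)) * (ennreal c * ball_integral (2 * R) x v)
        + ennreal (c * R powr Q) * (indicator {0<..} S * ?k S * ball_integral (2 * S) x v)"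
    proof cases
      case 2
      have "?k S * ennreal (c * min R S powr Q) = ennreal (S powr (\<kappa> - 1)) * ennreal c"
        using 2 c_pos by (simp add: ennreal_mult[symmetric] min_absorb2 powr_add[symmetric] mult.left_commute mult.commute[of _ c])
      moreover have "ball_integral (R + S) x v \<le> ball_integral (2 * R) x v"
        using 2 by (intro ball_integral_mono_radius) simp
      ultimately have "?k S * ennreal (c * min R S powr Q) * ball_integral (R + S) x v
          \<le> ennreal (S powr (\<kappa> - 1)) * ennreal c * ball_integral (2 * R) x v"
        by (simp add: mult_left_mono)
      then show ?thesis using 2 by (simp add: add_increasing2 mult.assoc)
    next
      case 3
      have "ball_integral (R + S) x v \<le> ball_integral (2 * S) x v"
        using 3 by (intro ball_integral_mono_radius) simp
      then have "?k S * (ennreal (c * min R S powr Q) * ball_integral (R + S) x v)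
          \<le> ?k S * (ennreal (c * R powr Q) * ball_integral (2 * S) x v)"
        using 3 by (intro mult_left_mono mult_mono) (auto simp: min_absorb1)
      also have "\<dots> = ennreal (c * R powr Q) * (?k S * ball_integral (2 * S) x v)"
        by (rule mult.left_commute)
      finally show ?thesis using 3 by simp
    qed simp
  qed
  also have "\<dots> = ennreal (R powr \<kappa> / \<kappa>) * (ennreal c * ball_integral (2 * R) x v)
      + ennreal (c * R powr Q) * (\<integral>\<^sup>+S. indicator {0<..} S * ?k S * ball_integral (2 * S) x v \<partial>lborel)"
    using nn_integral_powr_from_0[of \<kappa> R] R \<kappa>
    by (simp add: nn_integral_add nn_integral_multc nn_integral_cmult)
  \<comment> \<open>The substitution of \<open>2 * S\<close> for \<open>S\<close> turns the doubled
    balls into the potential itself, at the price of a power of \<open>2\<close>.\<close>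
  also have "(\<integral>\<^sup>+S. indicator {0<..} S * ?k S * ball_integral (2 * S) x v \<partial>lborel)
      = ennreal (2 powr (Q - \<kappa>)) * potential \<kappa> v x"
  proof -
    have "potential \<kappa> v x = ennreal \<bar>2\<bar> * (\<integral>\<^sup>+S. indicator {0<..} (0 + 2 * S) *
        ennreal ((0 + 2 * S) powr (\<kappa> - Q - 1)) * ball_integral (0 + 2 * S) x v \<partial>lborel)"
    proof -
      have "(\<lambda>S. indicator {0<..} S * ?k S * ball_integral S x v) \<in> borel_measurable borel"
        by measurable
      then show ?thesis
        unfolding potential_def by (rule nn_integral_real_affine) simp
    qed
    also have "\<dots> = (\<integral>\<^sup>+S. ennreal \<bar>2\<bar> * (indicator {0<..} (0 + 2 * S) *
        ennreal ((0 + 2 * S) powr (\<kappa> - Q - 1)) * ball_integral (0 + 2 * S) x v) \<partial>lborel)"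
      by (rule nn_integral_cmult[symmetric]) measurable
    also have "\<dots> = (\<integral>\<^sup>+S. ennreal (2 powr (\<kappa> - Q)) * (indicator {0<..} S * ?k S * ball_integral (2 * S) x v) \<partial>lborel)"
    proof (rule nn_integral_cong)
      fix S :: real
      show "ennreal \<bar>2\<bar> * (indicator {0<..} (0 + 2 * S) * ennreal ((0 + 2 * S) powr (\<kappa> - Q - 1)) * ball_integral (0 + 2 * S) x v)
        = ennreal (2 powr (\<kappa> - Q)) * (indicator {0<..} S * ?k S * ball_integral (2 * S) x v)"
      proof (cases "S > 0")
        case True
        have "2 * (2 * S) powr (\<kappa> - Q - 1) = 2 powr (\<kappa> - Q) * S powr (\<kappa> - Q - 1)"
          using True by (simp add: powr_mult powr_diff)
        then have "ennreal 2 * ennreal ((2 * S) powr (\<kappa> - Q - 1)) = ennreal (2 powr (\<kappa> - Q)) * ?k S"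
          by (simp only: ennreal_mult[symmetric] powr_ge_zero zero_le_numeral)
        then show ?thesis using True by (simp add: mult.assoc[symmetric])
      qed simp
    qed
    also have "\<dots> = ennreal (2 powr (\<kappa> - Q)) * (\<integral>\<^sup>+S. indicator {0<..} S * ?k S * ball_integral (2 * S) x v \<partial>lborel)"
      by (rule nn_integral_cmult) measurable
    finally have "ennreal (2 powr (Q - \<kappa>)) * potential \<kappa> v x = ennreal (2 powr (Q - \<kappa>)) * ennreal (2 powr (\<kappa> - Q)) *
       (\<integral>\<^sup>+S. indicator {0<..} S * ?k S * ball_integral (2 * S) x v \<partial>lborel)"
      by (simp only: mult.assoc)
    also have "ennreal (2 powr (Q - \<kappa>)) * ennreal (2 powr (\<kappa> - Q)) = 1"
      by (simp add: ennreal_mult[symmetric] powr_add[symmetric])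
    finally show ?thesis by simp
  qed
  \<comment> \<open>The single ball of radius \<open>2 * R\<close> that absorbed the small layers is
    itself dominated by the potential at its centre.\<close>
  also have "ennreal (R powr \<kappa> / \<kappa>) * (ennreal c * ball_integral (2 * R) x v)
      + ennreal (c * R powr Q) * (ennreal (2 powr (Q - \<kappa>)) * potential \<kappa> v x)
    \<le> ennreal (R powr \<kappa> / \<kappa>) * (ennreal c * (ennreal ((Q - \<kappa>) * (2 * R) powr (Q - \<kappa>)) * potential \<kappa> v x))
      + ennreal (c * R powr Q) * (ennreal (2 powr (Q - \<kappa>)) * potential \<kappa> v x)"
    using R \<kappa> by (intro add_mono mult_left_mono ball_integral_le_potential) auto
  also have "\<dots> = ennreal (R powr \<kappa> / \<kappa> * (c * ((Q - \<kappa>) * (2 * R) powr (Q - \<kappa>))) + c * R powr Q * 2 powr (Q - \<kappa>))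
      * potential \<kappa> v x"
  proof -
    have nonneg: "0 \<le> R powr \<kappa> / \<kappa>" "0 \<le> (Q - \<kappa>) * (2 * R) powr (Q - \<kappa>)" "0 \<le> c" "0 \<le> c * R powr Q"
      using R \<kappa> c_pos by simp_all
    then show ?thesis
      by (simp only: ennreal_plus ennreal_mult[of "R powr \<kappa> / \<kappa>"] ennreal_mult[of "c"] ennreal_mult[of "R powr Q"]
          mult_nonneg_nonneg powr_ge_zero distrib_right mult.assoc)
  qed
  also have "R powr \<kappa> / \<kappa> * (c * ((Q - \<kappa>) * (2 * R) powr (Q - \<kappa>))) + c * R powr Q * 2 powr (Q - \<kappa>)
     = c * 2 powr (Q - \<kappa>) * ((Q - \<kappa>) / \<kappa> + 1) * R powr Q"
  proof -
    have "R powr \<kappa> * (2 * R) powr (Q - \<kappa>) = 2 powr (Q - \<kappa>) * R powr Q"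
      using R by (simp add: powr_mult powr_add[symmetric])
    then have "R powr \<kappa> / \<kappa> * (c * ((Q - \<kappa>) * (2 * R) powr (Q - \<kappa>)))
        = c * (Q - \<kappa>) / \<kappa> * (2 powr (Q - \<kappa>) * R powr Q)"
      by (simp add: field_simps)
    then show ?thesis by (simp add: algebra_simps)
  qed
  finally show ?thesis .
qed

section \<open>Splitting of potentials and construction of the weight\<close>

lemma AE_finite_of_ball_integral_finite:
  assumes [measurable]: "u \<in> borel_measurable borel"
    and fin: "\<And>R. R > 0 \<Longrightarrow> ball_integral R 0 u < \<infinity>"
  shows "AE y in lborel. u y < \<infinity>"
proof -
  have "AE y in lborel. indicator {..<real (Suc n)} (N (y - 0)) * u y \<noteq> \<infinity>" for n
    using fin[of "real (Suc n)"] unfolding ball_integral_def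
    by (intro nn_integral_PInf_AE) auto
  then have "AE y in lborel. \<forall>n. indicator {..<real (Suc n)} (N (y - 0)) * u y \<noteq> \<infinity>"
    unfolding AE_all_countable by blast
  then show ?thesis
  proof eventually_elim
    case (elim y)
    obtain n where "N y < real n" using reals_Archimedean2 by blast
    then show ?case using elim[rule_format, of n] by (simp add: top.not_eq_extremum)
  qed
qed

text \<open>The factor \<open>R powr (Q - \<beta>)\<close> in the hypothesis cancels the kernel up
  to \<open>dR / R\<close>, so what remains is the scale-free integral of
  \<open>nn_integral_min_powr\<close>. Both Schur bounds are brought to this form.\<close>

lemma potential_le:
  assumes "a > 0" "b > 0" "h > 0" "K \<ge> 0"
    and bound: "\<And>R. R > 0 \<Longrightarrow> ball_integral R x g
      \<le> ennreal (K * (R powr (Q - \<beta>) * min ((R * h) powr a) ((R * h) powr - b)))"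
  shows "potential \<beta> g x \<le> ennreal (K * (1 / a + 1 / b))"
proof -
  have "potential \<beta> g x \<le> (\<integral>\<^sup>+R. ennreal K * (indicator {0<..} R *
      ennreal (R powr -1 * min ((R * h) powr a) ((R * h) powr - b))) \<partial>lborel)"
    unfolding potential_def
  proof (rule nn_integral_mono)
    fix R :: real
    show "indicator {0<..} R * ennreal (R powr (\<beta> - Q - 1)) * ball_integral R x g
      \<le> ennreal K * (indicator {0<..} R * ennreal (R powr -1 * min ((R * h) powr a) ((R * h) powr - b)))"
    proof (cases "R > 0")
      case True
      let ?m = "min ((R * h) powr a) ((R * h) powr - b)"
      have "ennreal (R powr (\<beta> - Q - 1)) * ball_integral R x g
          \<le> ennreal (R powr (\<beta> - Q - 1)) * ennreal (K * (R powr (Q - \<beta>) * ?m))"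
        by (intro mult_left_mono bound True) auto
      also have "\<dots> = ennreal (R powr (\<beta> - Q - 1) * (K * (R powr (Q - \<beta>) * ?m)))"
        by (subst ennreal_mult) (use assms in auto)
      also have "R powr (\<beta> - Q - 1) * (K * (R powr (Q - \<beta>) * ?m))
          = K * (R powr (\<beta> - Q - 1) * R powr (Q - \<beta>) * ?m)"
        by simp
      also have "R powr (\<beta> - Q - 1) * R powr (Q - \<beta>) = R powr -1"
        using True by (simp only: powr_add[symmetric]) simp
      also have "ennreal (K * (R powr -1 * ?m)) = ennreal K * ennreal (R powr -1 * ?m)"
        by (rule ennreal_mult) (use assms in auto)
      finally show ?thesis using True by simp
    qed simp
  qed
  also have "\<dots> = ennreal K * (\<integral>\<^sup>+R. indicator {0<..} R *
      ennreal (R powr -1 * min ((R * h) powr a) ((R * h) powr - b)) \<partial>lborel)"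
    by (rule nn_integral_cmult) measurable
  also have "\<dots> \<le> ennreal K * ennreal (1 / a + 1 / b)"
    by (intro mult_left_mono nn_integral_min_powr assms) auto
  also have "\<dots> = ennreal (K * (1 / a + 1 / b))"
    by (rule ennreal_mult[symmetric]) (use assms in auto)
  finally show ?thesis .
qed

text \<open>The weight \<open>h\<close> is normalised as an inverse length: \<open>1 / h x\<close> is the radius at which the two
  bounds available for \<open>ball_integral R x v\<close> coincide. In the proof,
  \<open>D\<close> times the indicator of the unit ball is added to \<open>v\<close> to keep \<open>h\<close> positive; its Morrey bound needs \<open>\<mu> \<le> Q\<close>.\<close>

lemma exists_weight:
  assumes \<kappa>: "0 < \<kappa>" "\<kappa> < \<mu>" "\<mu> \<le> Q"
  shows "\<exists>C>0. \<forall>v\<in>borel_measurable borel. \<forall>D>0.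
      (\<forall>S>0. \<forall>x. ball_integral S x v \<le> ennreal (D * S powr (Q - \<mu>))) \<longrightarrow>
      (\<exists>h\<in>borel_measurable borel. (\<forall>x. 0 \<le> h x) \<and> (AE x in lborel. h x > 0 \<and>
        (\<forall>R>0. ball_integral R x (\<lambda>y. ennreal (h y powr (\<mu> - \<kappa>)))
              \<le> ennreal (C * (R powr Q * min (h x) (1 / R) powr (\<mu> - \<kappa>))) \<and>
            ball_integral R x v \<le> ennreal (C * (D * (R powr (Q - \<mu>) * min 1 ((R * h x) powr (\<mu> - \<kappa>))))))))"
proof -
  define C1 where "C1 = c * 2 powr (Q - \<mu>) * (1 / \<kappa> + 1 / (\<mu> - \<kappa>)) * (1 + c)"
  define C2 where "C2 = c * 2 powr (Q - \<kappa>) * ((Q - \<kappa>) / \<kappa> + 1)"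
  \<comment> \<open>One summand for each bound below: Morrey decay of \<open>U\<close>, the
    \<open>A\<^sub>1\<close> property of \<open>U\<close>, Morrey decay of \<open>u\<close>, and the
    control of ball integrals of \<open>u\<close> by \<open>U\<close> at the centre.\<close>
  define C where "C = C1 + C2 + (1 + c) + (Q - \<kappa>)"
  have C12: "0 \<le> C1" "0 \<le> C2" using c_pos \<kappa> by (auto simp: C1_def C2_def)
  then have C: "C > 0" "C1 \<le> C" "C2 \<le> C" "1 + c \<le> C" "Q - \<kappa> \<le> C"
    using c_pos \<kappa> by (auto simp: C_def)
  show ?thesis
  proof (intro exI[of _ C] conjI C(1) ballI allI impI)
    fix v :: "'a \<Rightarrow> ennreal" and D :: real
    assume [measurable]: "v \<in> borel_measurable borel" and D: "D > 0"
      and "\<forall>S>0. \<forall>x. ball_integral S x v \<le> ennreal (D * S powr (Q - \<mu>))"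
    then have decay: "\<And>S x. S > 0 \<Longrightarrow> ball_integral S x v \<le> ennreal (D * S powr (Q - \<mu>))"
      by blast
    define e :: "'a \<Rightarrow> ennreal" where "e y = indicator {..<1} (N y)" for y
    have [measurable]: "e \<in> borel_measurable borel" unfolding e_def by measurable
    define u where "u y = v y + ennreal D * e y" for y
    have [measurable]: "u \<in> borel_measurable borel" unfolding u_def by measurable
    define U where "U = potential \<kappa> u"
    have [measurable]: "U \<in> borel_measurable borel" unfolding U_def by measurable
    \<comment> \<open>The integral is at most \<open>c * S powr Q\<close> and at most
      \<open>c\<close>. Since \<open>0 \<le> Q - \<mu> \<le> Q\<close>, the first is used for
      \<open>S \<le> 1\<close> and the second for \<open>S > 1\<close>.\<close>
    have e_le: "ball_integral S x e \<le> ennreal (c * S powr (Q - \<mu>))" if S: "S > 0" for S x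
    proof -
      have "ball_integral S x e \<le> ball_integral S x (\<lambda>_. 1)" "ball_integral S x e \<le> ball_integral 1 0 (\<lambda>_. 1)"
        unfolding ball_integral_def e_def by (intro nn_integral_mono; simp add: indicator_def)+
      then have le: "ball_integral S x e \<le> ennreal (c * S powr Q)" "ball_integral S x e \<le> ennreal (c * 1)"
        using ball_integral_one[OF S, of x] ball_integral_one[of 1 0] by (auto intro: order_trans)
      show ?thesis
      proof (cases "S \<le> 1")
        case True
        then have "S powr Q \<le> S powr (Q - \<mu>)" using S \<kappa> by (intro powr_mono') auto
        then show ?thesis using c_pos by (intro order_trans[OF le(1)] ennreal_leI mult_left_mono) simp_all
      next
        case False
        then have "1 \<le> S powr (Q - \<mu>)" using \<kappa> by (intro ge_one_powr_ge_zero) auto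
        then show ?thesis using c_pos by (intro order_trans[OF le(2)] ennreal_leI mult_left_mono) simp_all
      qed
    qed
    have u_decay: "ball_integral S x u \<le> ennreal ((1 + c) * D * S powr (Q - \<mu>))" if S: "S > 0" for S x
    proof -
      have "ball_integral S x u = ball_integral S x v + ennreal D * ball_integral S x e"
        unfolding ball_integral_def u_def
        by (simp add: distrib_left nn_integral_add mult.left_commute[of _ "ennreal D"] nn_integral_cmult)
      also have "\<dots> \<le> ennreal (D * S powr (Q - \<mu>)) + ennreal D * ennreal (c * S powr (Q - \<mu>))"
        by (intro add_mono mult_left_mono decay e_le S) auto
      also have "\<dots> = ennreal (D * S powr (Q - \<mu>) + D * (c * S powr (Q - \<mu>)))"
        using D c_pos by (simp add: ennreal_mult[symmetric] ennreal_plus[symmetric] del: ennreal_plus)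
      finally show ?thesis by (simp add: algebra_simps)
    qed
    have v_le: "ball_integral R x v \<le> ball_integral R x u" for R x
      by (rule ball_integral_mono) (simp add: u_def)
    have U_decay: "ball_integral R x U \<le> ennreal (C1 * (D * R powr (Q + \<kappa> - \<mu>)))" if "R > 0" for R x
      using ball_integral_potential_decay[of u R \<kappa> \<mu> "(1 + c) * D" x] that \<kappa> D c_pos u_decay
      by (simp add: U_def C1_def mult_ac)
    have U_A1: "ball_integral R x U \<le> ennreal (C2 * R powr Q) * U x" if "R > 0" for R x
      using ball_integral_potential_le_potential[of u R \<kappa> x] that \<kappa> by (simp add: U_def C2_def)
    \<comment> \<open>The ball of radius \<open>1 + N x\<close> about \<open>x\<close> contains the
      unit ball, on which \<open>u\<close> is at least \<open>D\<close>.\<close>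
    have U_pos: "U x > 0" for x
    proof -
      have T: "1 + N x > 0" using N_nonneg[of x] by simp
      have "emeasure lborel {y. N y < 1} = (\<integral>\<^sup>+y. indicator {y. N y < 1} y \<partial>lborel)"
        by (rule nn_integral_indicator[symmetric]) measurable
      also have "\<dots> \<le> ball_integral (1 + N x) x e"
        unfolding ball_integral_def e_def
      proof (intro nn_integral_mono)
        fix y
        show "indicator {y. N y < 1} y \<le> (indicator {..<1 + N x} (N (y - x)) * indicator {..<1} (N y) :: ennreal)"
          using N_triangle[of y "- x"] N_minus[of x] by (auto simp: indicator_def)
      qed
      finally have "0 < ball_integral (1 + N x) x e" using unit_ball_pos by (rule less_le_trans[rotated])
      then have "0 < ennreal D * ball_integral (1 + N x) x e"
        using D by (simp add: ennreal_zero_less_mult_iff)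
      also have "ennreal D * ball_integral (1 + N x) x e \<le> ball_integral (1 + N x) x u"
        unfolding ball_integral_cmult[OF \<open>e \<in> borel_measurable borel\<close>, symmetric]
        by (rule ball_integral_mono) (simp add: u_def)
      finally have "0 < ball_integral (1 + N x) x u" .
      moreover have "ennreal ((1 + N x) powr (\<kappa> - Q) / (Q - \<kappa>)) > 0"
        using T \<kappa> by simp
      ultimately have "0 < ennreal ((1 + N x) powr (\<kappa> - Q) / (Q - \<kappa>)) * ball_integral (1 + N x) x u"
        by (simp add: ennreal_zero_less_mult_iff)
      also have "\<dots> \<le> U x"
        unfolding U_def by (rule potential_ge_ball_integral) (use T \<kappa> in auto)
      finally show ?thesis .
    qed
    \<comment> \<open>Where \<open>U\<close> is infinite, \<open>enn2real\<close> gives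
      \<open>h x = 0\<close>. This happens only on a null set, and it keeps
      \<open>h y powr (\<mu> - \<kappa>)\<close> below \<open>U y / D\<close> everywhere.\<close>
    define h where "h x = (enn2real (U x) / D) powr (1 / (\<mu> - \<kappa>))" for x
    have [measurable]: "h \<in> borel_measurable borel" unfolding h_def by measurable
    have h_powr: "h x powr (\<mu> - \<kappa>) = enn2real (U x) / D" for x
      using \<kappa> D by (simp add: h_def powr_powr)
    have int_h: "ball_integral R x (\<lambda>y. ennreal (h y powr (\<mu> - \<kappa>))) \<le> ennreal (1 / D) * ball_integral R x U" for R x
    proof -
      have "ennreal (h y powr (\<mu> - \<kappa>)) \<le> ennreal (1 / D) * U y" for y
      proof -
        have "ennreal (h y powr (\<mu> - \<kappa>)) = ennreal (1 / D) * ennreal (enn2real (U y))"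
          using D by (simp add: h_powr ennreal_mult[symmetric])
        also have "\<dots> \<le> ennreal (1 / D) * U y"
          by (intro mult_left_mono) (auto simp: ennreal_enn2real_if)
        finally show ?thesis .
      qed
      then show ?thesis
        unfolding ball_integral_cmult[OF \<open>U \<in> borel_measurable borel\<close>, symmetric]
        by (rule ball_integral_mono)
    qed
    have "AE x in lborel. U x < \<infinity>"
      by (rule AE_finite_of_ball_integral_finite)
        (auto intro: le_less_trans[OF U_decay])
    then have "AE x in lborel. h x > 0 \<and>
        (\<forall>R>0. ball_integral R x (\<lambda>y. ennreal (h y powr (\<mu> - \<kappa>)))
              \<le> ennreal (C * (R powr Q * min (h x) (1 / R) powr (\<mu> - \<kappa>))) \<and>
            ball_integral R x v \<le> ennreal (C * (D * (R powr (Q - \<mu>) * min 1 ((R * h x) powr (\<mu> - \<kappa>))))))"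
    proof eventually_elim
      case (elim x)
      have "0 < enn2real (U x)" using elim U_pos[of x] by (simp add: enn2real_positive_iff)
      then have h_pos: "h x > 0" using D by (simp add: h_def)
      have Ux: "U x = ennreal (D * h x powr (\<mu> - \<kappa>))"
        using elim D by (simp add: h_powr)
      show ?case
      proof (intro conjI allI impI h_pos)
        fix R :: real assume R: "R > 0"
        let ?J = "ball_integral R x (\<lambda>y. ennreal (h y powr (\<mu> - \<kappa>)))"
        have "?J \<le> ennreal (1 / D) * ennreal (C1 * (D * R powr (Q + \<kappa> - \<mu>)))"
          by (rule order_trans[OF int_h]) (intro mult_left_mono U_decay R, simp)
        also have "\<dots> = ennreal (C1 * (R powr Q * (1 / R) powr (\<mu> - \<kappa>)))"
          using D R C12 by (subst ennreal_mult[symmetric]) (auto simp: powr_divide powr_diff powr_add)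
        also have "\<dots> \<le> ennreal (C * (R powr Q * (1 / R) powr (\<mu> - \<kappa>)))"
          using C by (intro ennreal_leI mult_right_mono) auto
        finally have J1: "?J \<le> ennreal (C * (R powr Q * (1 / R) powr (\<mu> - \<kappa>)))" .
        have "?J \<le> ennreal (1 / D) * (ennreal (C2 * R powr Q) * U x)"
          by (rule order_trans[OF int_h]) (intro mult_left_mono U_A1 R, simp)
        also have "\<dots> = ennreal (C2 * (R powr Q * h x powr (\<mu> - \<kappa>)))"
          using D R C12 by (simp add: Ux ennreal_mult[symmetric])
        also have "\<dots> \<le> ennreal (C * (R powr Q * h x powr (\<mu> - \<kappa>)))"
          using C by (intro ennreal_leI mult_right_mono) auto
        finally have "?J \<le> ennreal (C * (R powr Q * h x powr (\<mu> - \<kappa>)))" .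
        with J1 show "?J \<le> ennreal (C * (R powr Q * min (h x) (1 / R) powr (\<mu> - \<kappa>)))"
          by (simp add: min_def)
        have "ball_integral R x v \<le> ennreal ((1 + c) * D * R powr (Q - \<mu>))"
          using v_le u_decay[OF R] by (rule order_trans)
        also have "\<dots> \<le> ennreal (C * (D * (R powr (Q - \<mu>) * 1)))"
          using C D by (intro ennreal_leI) (simp add: mult_right_mono)
        finally have J2: "ball_integral R x v \<le> ennreal (C * (D * (R powr (Q - \<mu>) * 1)))" .
        have "ball_integral R x v \<le> ennreal ((Q - \<kappa>) * R powr (Q - \<kappa>)) * U x"
          unfolding U_def using v_le by (rule order_trans) (intro ball_integral_le_potential; use R \<kappa> in simp)
        also have "\<dots> = ennreal ((Q - \<kappa>) * (D * (R powr (Q - \<kappa>) * h x powr (\<mu> - \<kappa>))))"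
          using D \<kappa> by (simp add: Ux ennreal_mult[symmetric] mult_ac)
        also have "R powr (Q - \<kappa>) * h x powr (\<mu> - \<kappa>) = R powr (Q - \<mu>) * (R * h x) powr (\<mu> - \<kappa>)"
          using R h_pos by (simp add: powr_mult powr_add[symmetric])
        also have "ennreal ((Q - \<kappa>) * (D * (R powr (Q - \<mu>) * (R * h x) powr (\<mu> - \<kappa>))))
            \<le> ennreal (C * (D * (R powr (Q - \<mu>) * (R * h x) powr (\<mu> - \<kappa>))))"
          using C D by (intro ennreal_leI mult_right_mono) auto
        finally have "ball_integral R x v \<le> \<dots>" .
        with J2 show "ball_integral R x v \<le> ennreal (C * (D * (R powr (Q - \<mu>) * min 1 ((R * h x) powr (\<mu> - \<kappa>)))))"
          unfolding min_def by (simp only: simp_thms split: if_split)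
      qed
    qed
    then show "\<exists>h\<in>borel_measurable borel. (\<forall>x. 0 \<le> h x) \<and> (AE x in lborel. h x > 0 \<and>
        (\<forall>R>0. ball_integral R x (\<lambda>y. ennreal (h y powr (\<mu> - \<kappa>)))
              \<le> ennreal (C * (R powr Q * min (h x) (1 / R) powr (\<mu> - \<kappa>))) \<and>
            ball_integral R x v \<le> ennreal (C * (D * (R powr (Q - \<mu>) * min 1 ((R * h x) powr (\<mu> - \<kappa>)))))))"
      by (intro bexI[of _ h] conjI) (simp_all add: h_def)
  qed
qed

text \<open>Jensen's inequality for ball averages: Hoelder against the constant \<open>1\<close>
  with exponents \<open>m / s\<close> and \<open>m / (m - s)\<close>, where the ball volume produces
  the power of \<open>c\<close>. Thus control of the averages of \<open>h powr m\<close> carries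
  over to all smaller powers.\<close>

lemma ball_integral_powr_le:
  assumes [measurable]: "h \<in> borel_measurable borel" and h0: "\<And>y. 0 \<le> h y"
    and s: "0 < s" "s < m" and R: "R > 0" and C: "C \<ge> 0" and t: "t > 0"
    and bound: "ball_integral R x (\<lambda>y. ennreal (h y powr m)) \<le> ennreal (C * (R powr Q * t powr m))"
  shows "ball_integral R x (\<lambda>y. ennreal (h y powr s))
    \<le> ennreal (C powr (s / m) * c powr (1 - s / m) * (R powr Q * t powr s))"
proof -
  have "(\<integral>\<^sup>+y. indicator {..<R} (N (y - x)) * ennreal (h y powr s * 1) \<partial>lborel)
    \<le> ennreal ((C * (R powr Q * t powr m)) powr (1 / (m / s)) * (c * R powr Q) powr (1 / (m / (m - s))))"
  proof (rule nn_integral_weighted_Holder)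
    show "(\<integral>\<^sup>+y. indicator {..<R} (N (y - x)) * ennreal ((h y powr s) powr (m / s)) \<partial>lborel)
        \<le> ennreal (C * (R powr Q * t powr m))"
      using bound s by (simp add: ball_integral_def powr_powr)
    show "(\<integral>\<^sup>+y. indicator {..<R} (N (y - x)) * ennreal (1 powr (m / (m - s))) \<partial>lborel) \<le> ennreal (c * R powr Q)"
      using ball_integral_one[OF R, of x] by (simp add: ball_integral_def)
  qed (use s C c_pos in \<open>auto simp: field_simps\<close>)
  also have "(C * (R powr Q * t powr m)) powr (1 / (m / s)) * (c * R powr Q) powr (1 / (m / (m - s)))
      = C powr (s / m) * c powr (1 - s / m) * (R powr Q * t powr s)"
  proof -
    have e: "1 / (m / (m - s)) = 1 - s / m" using s by (simp add: field_simps)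
    have "(R powr Q) powr (s / m) * (R powr Q) powr (1 - s / m) = R powr Q"
      using R by (simp add: powr_add[symmetric])
    moreover have "(t powr m) powr (s / m) = t powr s" using s t by (simp add: powr_powr)
    ultimately show ?thesis unfolding e using R C t c_pos s by (simp add: powr_mult mult_ac)
  qed
  finally show ?thesis by (simp add: ball_integral_def)
qed

section \<open>The kernel form of the potential and Schur's test\<close>

definition kern :: "real \<Rightarrow> real \<Rightarrow> ennreal" where
  "kern \<beta> t = (\<integral>\<^sup>+R. indicator {0<..} R * ennreal (R powr (\<beta> - Q - 1)) * indicator {t<..} R \<partial>lborel)"

lemma kern_measurable [measurable]:
  assumes [measurable]: "F \<in> borel_measurable M"
  shows "(\<lambda>z. kern \<beta> (F z)) \<in> borel_measurable M"
proof -
  have "kern \<beta> t = (\<integral>\<^sup>+R. indicator {0<..} R * ennreal (R powr (\<beta> - Q - 1)) * (if t < R then 1 else 0) \<partial>lborel)" for t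
    unfolding kern_def by (intro nn_integral_cong) (simp add: indicator_def)
  then show ?thesis by simp
qed

text \<open>Tonelli in the radius and the space variable. The layer-cake form suits estimates over
  balls; this form displays the symmetric kernel that duality requires.\<close>

lemma potential_eq_kern:
  assumes [measurable]: "g \<in> borel_measurable borel"
  shows "potential \<beta> g x = (\<integral>\<^sup>+y. kern \<beta> (N (y - x)) * g y \<partial>lborel)"
proof -
  let ?k = "\<lambda>R. indicator {0<..} R * ennreal (R powr (\<beta> - Q - 1))"
  have [measurable]: "N \<in> borel_measurable lborel" "g \<in> borel_measurable lborel" by simp_all
  have "potential \<beta> g x = (\<integral>\<^sup>+R. \<integral>\<^sup>+y. ?k R * ((if N (y - x) < R then 1 else 0) * g y) \<partial>lborel \<partial>lborel)"
    unfolding potential_def ball_integral_def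
    by (intro nn_integral_cong, subst nn_integral_cmult[symmetric])
      (auto intro!: nn_integral_cong simp: indicator_def)
  also have "\<dots> = (\<integral>\<^sup>+y. \<integral>\<^sup>+R. ?k R * ((if N (y - x) < R then 1 else 0) * g y) \<partial>lborel \<partial>lborel)"
    by (rule lborel_pair.Fubini') measurable
  also have "\<dots> = (\<integral>\<^sup>+y. kern \<beta> (N (y - x)) * g y \<partial>lborel)"
    unfolding kern_def
    by (intro nn_integral_cong, subst nn_integral_multc[symmetric])
      (auto intro!: nn_integral_cong simp: indicator_def)
  finally show ?thesis .
qed

lemma kern_eq:
  assumes "t > 0" "\<beta> < Q"
  shows "kern \<beta> t = ennreal (t powr (\<beta> - Q) / (Q - \<beta>))"
proof -
  have "kern \<beta> t = (\<integral>\<^sup>+R. indicator {t..} R * ennreal (R powr (- (Q - \<beta>) - 1)) \<partial>lborel)"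
    unfolding kern_def
  proof (rule nn_integral_cong_AE)
    show "AE R in lborel. indicator {0<..} R * ennreal (R powr (\<beta> - Q - 1)) * indicator {t<..} R
        = indicator {t..} R * ennreal (R powr (- (Q - \<beta>) - 1))"
      using AE_lborel_singleton[of t]
      by eventually_elim (use assms in \<open>auto simp: indicator_def\<close>)
  qed
  also have "\<dots> = ennreal (t powr - (Q - \<beta>) / (Q - \<beta>))"
    using assms by (intro nn_integral_powr_to_inf) auto
  finally show ?thesis by simp
qed

text \<open>Writing \<open>f = F * \<phi> powr (1 / q)\<close> and applying Hoelder with respect to
  the kernel gives \<open>g powr p \<le> G * (K1 * \<psi>) powr (p - 1)\<close>. After integration
  against \<open>w\<close>, Tonelli and the symmetry of the kernel move the potential onto
  \<open>w * \<psi> powr (p - 1)\<close>, and the second hypothesis restores the power of \<phi>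
  that was divided out. The function \<open>g\<close> enters only through its pointwise
  bound.\<close>

lemma Schur_test:
  fixes w f g \<phi> \<psi> :: "'a \<Rightarrow> real"
  assumes p: "p > 1"
    and [measurable]: "w \<in> borel_measurable borel" "f \<in> borel_measurable borel"
      "\<phi> \<in> borel_measurable borel" "\<psi> \<in> borel_measurable borel"
    and nonneg: "\<And>x. 0 \<le> w x" "\<And>x. 0 \<le> f x" "\<And>x. 0 \<le> g x" "\<And>x. 0 \<le> \<phi> x" "\<And>x. 0 \<le> \<psi> x"
    and K: "K1 > 0" "K2 > 0"
    and pos: "AE x in lborel. \<phi> x > 0 \<and> \<psi> x > 0"
    and \<phi>: "AE x in lborel. potential \<beta> (\<lambda>y. ennreal (\<phi> y)) x \<le> ennreal (K1 * \<psi> x)"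
    and \<psi>: "AE x in lborel. potential \<beta> (\<lambda>y. ennreal (w y * \<psi> y powr (p - 1))) x \<le> ennreal (K2 * \<phi> x powr (p - 1))"
    and g: "\<And>x. ennreal (g x) \<le> potential \<beta> (\<lambda>y. ennreal (f y)) x"
  shows "(\<integral>\<^sup>+x. ennreal (w x * g x powr p) \<partial>lborel)
    \<le> ennreal (K1 powr (p - 1) * K2) * (\<integral>\<^sup>+x. ennreal (f x powr p) \<partial>lborel)"
proof -
  define q where "q = p / (p - 1)"
  have q: "q > 1" "1 / p + 1 / q = 1" using p by (auto simp: q_def field_simps)
  define F where "F y = f y / \<phi> y powr (1 / q)" for y
  have [measurable]: "F \<in> borel_measurable borel" unfolding F_def by measurable
  have F0: "F y \<ge> 0" for y using nonneg by (simp add: F_def)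
  define G where "G x = (\<integral>\<^sup>+y. kern \<beta> (N (y - x)) * ennreal (F y powr p) \<partial>lborel)" for x
  have pointwise: "AE x in lborel. ennreal (w x * g x powr p)
      \<le> ennreal (K1 powr (p - 1)) * (ennreal (w x * \<psi> x powr (p - 1)) * G x)"
    using \<phi> pos
  proof eventually_elim
    case (elim x)
    \<comment> \<open>If \<open>G x\<close> is infinite and \<open>w x\<close> is positive, then
      \<open>\<psi> x > 0\<close> makes the right-hand side infinite; if \<open>w x = 0\<close>, the
      left-hand side vanishes.\<close>
    show ?case
    proof (cases "w x = 0 \<or> G x = \<infinity>")
      case True
      then show ?thesis
        using elim nonneg(1)[of x] K by (cases "w x = 0") (auto simp: ennreal_mult_top ennreal_mult_eq_top_iff)
    next
      case False
      then obtain a where a: "G x = ennreal a" "a \<ge> 0" by (cases "G x") auto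
      have "ennreal (g x) \<le> (\<integral>\<^sup>+y. kern \<beta> (N (y - x)) * ennreal (f y) \<partial>lborel)"
        using g[of x] by (simp add: potential_eq_kern)
      also have "\<dots> = (\<integral>\<^sup>+y. kern \<beta> (N (y - x)) * ennreal (F y * \<phi> y powr (1 / q)) \<partial>lborel)"
        by (rule nn_integral_cong_AE) (use pos in eventually_elim, auto simp: F_def)
      also have "\<dots> \<le> ennreal (a powr (1 / p) * (K1 * \<psi> x) powr (1 / q))"
      proof (rule nn_integral_weighted_Holder)
        show "(\<integral>\<^sup>+y. kern \<beta> (N (y - x)) * ennreal (F y powr p) \<partial>lborel) \<le> ennreal a"
          using a by (simp add: G_def)
        show "(\<integral>\<^sup>+y. kern \<beta> (N (y - x)) * ennreal ((\<phi> y powr (1 / q)) powr q) \<partial>lborel) \<le> ennreal (K1 * \<psi> x)"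
          using elim q nonneg by (simp add: potential_eq_kern powr_powr)
      qed (use p q nonneg F0 a K in auto)
      finally have "g x \<le> a powr (1 / p) * (K1 * \<psi> x) powr (1 / q)"
        by (subst (asm) ennreal_le_iff) auto
      then have "g x powr p \<le> (a powr (1 / p) * (K1 * \<psi> x) powr (1 / q)) powr p"
        using p nonneg by (intro powr_mono2) auto
      also have "\<dots> = a * (K1 powr (p - 1) * \<psi> x powr (p - 1))"
      proof -
        have "1 / q * p = p - 1" using p by (simp add: q_def)
        then show ?thesis using p a K nonneg by (simp add: powr_mult powr_powr)
      qed
      finally have "w x * g x powr p \<le> w x * (a * (K1 powr (p - 1) * \<psi> x powr (p - 1)))"
        using nonneg by (intro mult_left_mono) auto
      then have "ennreal (w x * g x powr p) \<le> ennreal (K1 powr (p - 1) * (w x * \<psi> x powr (p - 1) * a))"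
        by (intro ennreal_leI) (simp add: mult_ac)
      also have "\<dots> = ennreal (K1 powr (p - 1)) * (ennreal (w x * \<psi> x powr (p - 1)) * G x)"
        using a nonneg by (simp add: ennreal_mult)
      finally show ?thesis .
    qed
  qed
  let ?k = "\<lambda>x y. ennreal (w x * \<psi> x powr (p - 1)) * (kern \<beta> (N (y - x)) * ennreal (F y powr p))"
  have "(\<integral>\<^sup>+x. ennreal (w x * g x powr p) \<partial>lborel)
      \<le> (\<integral>\<^sup>+x. ennreal (K1 powr (p - 1)) * (ennreal (w x * \<psi> x powr (p - 1)) * G x) \<partial>lborel)"
    by (rule nn_integral_mono_AE[OF pointwise])
  also have "\<dots> = ennreal (K1 powr (p - 1)) * (\<integral>\<^sup>+x. \<integral>\<^sup>+y. ?k x y \<partial>lborel \<partial>lborel)"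
    unfolding G_def by (simp add: nn_integral_cmult)
  also have "(\<integral>\<^sup>+x. \<integral>\<^sup>+y. ?k x y \<partial>lborel \<partial>lborel) = (\<integral>\<^sup>+y. \<integral>\<^sup>+x. ?k x y \<partial>lborel \<partial>lborel)"
    by (rule lborel_pair.Fubini'[symmetric]) measurable
  also have "\<dots> = (\<integral>\<^sup>+y. ennreal (F y powr p) * potential \<beta> (\<lambda>x. ennreal (w x * \<psi> x powr (p - 1))) y \<partial>lborel)"
    by (simp add: potential_eq_kern nn_integral_cmult[symmetric] mult_ac N_commute)
  also have "\<dots> \<le> (\<integral>\<^sup>+y. ennreal K2 * ennreal (f y powr p) \<partial>lborel)"
  proof (rule nn_integral_mono_AE)
    show "AE y in lborel. ennreal (F y powr p) * potential \<beta> (\<lambda>x. ennreal (w x * \<psi> x powr (p - 1))) y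
        \<le> ennreal K2 * ennreal (f y powr p)"
      using \<psi> pos
    proof eventually_elim
      case (elim y)
      have "F y powr p * \<phi> y powr (p - 1) = f y powr p"
      proof -
        have "1 / q * p = p - 1" using p by (simp add: q_def)
        then show ?thesis using elim nonneg by (simp add: F_def powr_divide powr_powr)
      qed
      then have eq: "F y powr p * (K2 * \<phi> y powr (p - 1)) = K2 * f y powr p"
        by (simp add: mult.left_commute)
      have "ennreal (F y powr p) * potential \<beta> (\<lambda>x. ennreal (w x * \<psi> x powr (p - 1))) y
          \<le> ennreal (F y powr p) * ennreal (K2 * \<phi> y powr (p - 1))"
        using elim by (intro mult_left_mono) auto
      also have "\<dots> = ennreal K2 * ennreal (f y powr p)"
        using K by (simp add: ennreal_mult[symmetric] eq)
      finally show ?case .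
    qed
  qed
  also have "\<dots> = ennreal K2 * (\<integral>\<^sup>+y. ennreal (f y powr p) \<partial>lborel)"
    by (rule nn_integral_cmult) measurable
  finally show ?thesis using K by (simp add: ennreal_mult mult.assoc mult_left_mono)
qed

end

section \<open>Exponent identities for the two Schur bounds\<close>

lemma min_powr_pos_neg:
  fixes u :: real
  assumes "u > 0" "a > 0" "b > 0"
  shows "min (u powr a) (u powr - b) = (if u \<le> 1 then u powr a else u powr - b)"
proof (cases "u \<le> 1")
  case True
  then have "u powr a \<le> u powr - b" using assms by (intro powr_mono') auto
  then show ?thesis using True by simp
next
  case False
  then have "u powr - b \<le> u powr a" using assms by (intro powr_mono) auto
  then show ?thesis using False by simp
qed

text \<open>Both minima switch at \<open>R * h = 1\<close>. The right-hand side is in the form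
  required by \<open>potential_le\<close>, with exponent \<beta> at small radii and
  \<open>- \<delta>\<close> at large radii, and the factor \<open>h powr \<delta>\<close> is the
  Schur bound for the first potential.\<close>

lemma min_inverse_powr:
  fixes R h Q \<beta> \<delta> :: real
  assumes "R > 0" "h > 0" "\<beta> > 0" "\<delta> > 0"
  shows "R powr Q * min h (1 / R) powr (\<beta> + \<delta>)
    = h powr \<delta> * (R powr (Q - \<beta>) * min ((R * h) powr \<beta>) ((R * h) powr - \<delta>))"
proof (cases "R * h \<le> 1")
  case True
  then have "min h (1 / R) = h" using assms by (simp add: field_simps)
  then show ?thesis
    unfolding min_powr_pos_neg[OF mult_pos_pos[OF assms(1,2)] assms(3,4)]
    using True assms by (simp add: powr_def ln_mult mult_exp_exp algebra_simps)
next
  case False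
  then have "min h (1 / R) = 1 / R" using assms by (simp add: field_simps)
  then show ?thesis
    unfolding min_powr_pos_neg[OF mult_pos_pos[OF assms(1,2)] assms(3,4)]
    using False assms by (simp add: powr_def ln_mult ln_div mult_exp_exp algebra_simps)
qed

text \<open>The left-hand side is the Hoelder product of the bounds for the averages of
  \<open>w powr r\<close> and of a power of \<open>h\<close>. Again everything switches at
  \<open>R * h = 1\<close>. The loss of \<kappa> in the first factor, diluted by the root, becomes
  the exponent \<open>\<beta> - \<kappa> / r\<close>.\<close>

lemma Holder_bound_eq:
  fixes R h Q \<nu> \<beta> \<kappa> r s :: real
  assumes R: "R > 0" and h: "h > 0" and r: "r > 1" and \<kappa>: "\<kappa> < \<beta> * r" "\<kappa> < \<nu> * r" and s: "s > 0" "\<nu> > \<beta>"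
  shows "(R powr (Q - \<nu> * r) * min 1 ((R * h) powr (\<nu> * r - \<kappa>))) powr (1 / r)
      * (R powr Q * min h (1 / R) powr (s * (r / (r - 1)))) powr (1 / (r / (r - 1)))
    = h powr (\<nu> - \<beta> + s) * (R powr (Q - \<beta>) *
        min ((R * h) powr (\<beta> - \<kappa> / r)) ((R * h) powr - (\<nu> - \<beta> + s)))"
proof -
  have e: "1 / (r / (r - 1)) = 1 - 1 / r" using r by (simp add: field_simps)
  have pos: "R * h > 0" "\<beta> - \<kappa> / r > 0" "\<nu> - \<beta> + s > 0"
    using R h r \<kappa> s by (auto simp: field_simps)
  have 1: "(R powr (Q - \<nu> * r)) powr (1 / r) = R powr (Q / r - \<nu>)"
    using r by (simp add: powr_powr diff_divide_distrib)
  have 2: "(R powr Q) powr (1 - 1 / r) = R powr (Q - Q / r)"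
    by (simp add: powr_powr right_diff_distrib)
  have 3: "(t powr (s * (r / (r - 1)))) powr (1 - 1 / r) = t powr s" for t :: real
  proof -
    have "s * (r / (r - 1)) * (1 - 1 / r) = s" using r by (simp add: field_simps)
    then show ?thesis by (simp add: powr_powr)
  qed
  show ?thesis
  proof (cases "R * h \<le> 1")
    case True
    then have "min h (1 / R) = h" using R by (simp add: field_simps)
    moreover have "min 1 ((R * h) powr (\<nu> * r - \<kappa>)) = (R * h) powr (\<nu> * r - \<kappa>)"
    proof -
      have "(R * h) powr (\<nu> * r - \<kappa>) \<le> 1"
        using True pos \<kappa> powr_mono'[of 0 "\<nu> * r - \<kappa>" "R * h"] R h by simp
      then show ?thesis by simp
    qed
    moreover have "((R * h) powr (\<nu> * r - \<kappa>)) powr (1 / r) = (R * h) powr (\<nu> - \<kappa> / r)"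
      using r by (simp add: powr_powr diff_divide_distrib)
    ultimately show ?thesis
      unfolding e min_powr_pos_neg[OF pos] using True R h
      by (simp only: powr_mult[of "_ powr _"] 1 2 3 if_True)
        (simp add: powr_def ln_mult mult_exp_exp algebra_simps)
  next
    case False
    then have "min h (1 / R) = 1 / R" using R by (simp add: field_simps)
    moreover have "min 1 ((R * h) powr (\<nu> * r - \<kappa>)) = 1"
    proof -
      have "1 \<le> (R * h) powr (\<nu> * r - \<kappa>)"
        using False pos \<kappa> by (intro ge_one_powr_ge_zero) auto
      then show ?thesis by simp
    qed
    ultimately show ?thesis
      unfolding e min_powr_pos_neg[OF pos] using False R h
      by (simp only: powr_mult[of "_ powr _"] 1 2 3 if_False mult_1_right)
        (simp add: powr_def ln_mult ln_div mult_exp_exp algebra_simps)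
  qed
qed

section \<open>The trace inequality under a Morrey condition\<close>

context homogeneous_norm begin

text \<open>The constant is chosen before \<open>A\<close>, and the bound is linear in
  \<open>A\<close>. This works because \<open>h\<close> is normalised by \<open>A powr r\<close>:
  the first Schur bound is then free of \<open>A\<close>, and Hoelder takes the \<open>r\<close>-th
  root of \<open>A powr r\<close> in the second.\<close>

theorem trace_inequality:
  assumes \<beta>: "\<beta> > 0" and p: "p > 1" and r: "r > 1" and Q: "\<beta> * p * r \<le> Q"
  shows "\<exists>C>0. \<forall>w\<in>borel_measurable borel. \<forall>f\<in>borel_measurable borel. \<forall>g. \<forall>A>0.
      (\<forall>x. 0 \<le> w x) \<longrightarrow> (\<forall>x. 0 \<le> f x) \<longrightarrow> (\<forall>x. 0 \<le> g x) \<longrightarrow>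
      (\<forall>R>0. \<forall>x. ball_integral R x (\<lambda>y. ennreal (w y powr r)) \<le> ennreal (A powr r * R powr (Q - \<beta> * p * r))) \<longrightarrow>
      (\<forall>x. ennreal (g x) \<le> potential \<beta> (\<lambda>y. ennreal (f y)) x) \<longrightarrow>
      (\<integral>\<^sup>+x. ennreal (w x * g x powr p) \<partial>lborel) \<le> ennreal (C * A) * (\<integral>\<^sup>+x. ennreal (f x powr p) \<partial>lborel)"
proof -
  define \<nu> where "\<nu> = \<beta> * p"
  \<comment> \<open>Half of the largest value meeting two demands:
    \<open>\<kappa> < \<beta> * r\<close>, so that \<open>\<beta> - \<kappa> / r\<close> is
    positive, and \<open>\<kappa> < \<beta> * (p * r - 1)\<close>, that is
    \<open>\<beta> < m\<close>, which leaves room for \<delta>.\<close>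
  define \<kappa> where "\<kappa> = \<beta> * (min r (p * r - 1) / 2)"
  define m where "m = \<nu> * r - \<kappa>"
  define q where "q = r / (r - 1)"
  \<comment> \<open>The first entry gives \<open>\<beta> + \<delta> < m\<close>, the second
    \<open>s * q < m\<close>; these are the two powers of \<open>h\<close> whose averages are
    deduced from those of \<open>h powr m\<close>.\<close>
  define \<delta> where "\<delta> = min ((m - \<beta>) / 2) (m / (2 * ((p - 1) * q)))"
  define s where "s = \<delta> * (p - 1)"
  have pr: "p * r > 1" using p r by (simp add: less_1_mult)
  have \<nu>: "\<nu> > \<beta>" using \<beta> p by (simp add: \<nu>_def)
  have q: "q > 1" "1 / r + 1 / q = 1" using r by (auto simp: q_def field_simps)
  have "\<kappa> > 0" using \<beta> pr r by (simp add: \<kappa>_def)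
  have "min r (p * r - 1) / 2 < r" "min r (p * r - 1) / 2 < p * r - 1"
    using r pr by (simp_all add: min_def)
  then have "\<kappa> < \<beta> * r" "\<kappa> < \<beta> * (p * r - 1)"
    unfolding \<kappa>_def using \<beta> by (intro mult_strict_left_mono; simp)+
  then have \<kappa>: "0 < \<kappa>" "\<kappa> < \<beta> * r" "\<beta> < m" "\<kappa> < \<nu> * r"
    using \<open>\<kappa> > 0\<close> \<beta> by (auto simp: m_def \<nu>_def algebra_simps)
  have \<nu>r: "\<nu> * r \<le> Q" using Q by (simp add: \<nu>_def)
  have m: "m > 0" using \<kappa> \<beta> by simp
  have \<delta>: "\<delta> > 0" using \<kappa> m p q by (simp add: \<delta>_def)
  have \<delta>1: "\<beta> + \<delta> < m"
  proof -
    have "\<delta> \<le> (m - \<beta>) / 2" unfolding \<delta>_def by (rule min.cobounded1)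
    then show ?thesis using \<kappa> by (simp add: field_simps)
  qed
  have s: "s > 0" using \<delta> p by (simp add: s_def)
  have sq: "0 < s * q" "s * q < m"
  proof -
    have "\<delta> * ((p - 1) * q) \<le> m / (2 * ((p - 1) * q)) * ((p - 1) * q)"
      using p q by (intro mult_right_mono) (auto simp: \<delta>_def)
    also have "\<dots> = m / 2"
    proof -
      have "m / (2 * z) * z = m / 2" if "z \<noteq> 0" for z
        using that by simp
      then show ?thesis using p q by simp
    qed
    finally show "s * q < m" using m by (simp add: s_def mult.assoc)
    show "0 < s * q" using s q by simp
  qed
  obtain C0 where C0: "C0 > 0" and weight: "\<forall>v\<in>borel_measurable borel. \<forall>D>0.
      (\<forall>S>0. \<forall>x. ball_integral S x v \<le> ennreal (D * S powr (Q - \<nu> * r))) \<longrightarrow>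
      (\<exists>h\<in>borel_measurable borel. (\<forall>x. 0 \<le> h x) \<and> (AE x in lborel. h x > 0 \<and>
        (\<forall>R>0. ball_integral R x (\<lambda>y. ennreal (h y powr m))
              \<le> ennreal (C0 * (R powr Q * min (h x) (1 / R) powr m)) \<and>
            ball_integral R x v \<le> ennreal (C0 * (D * (R powr (Q - \<nu> * r) * min 1 ((R * h x) powr m)))))))"
    using exists_weight[OF \<kappa>(1,4) \<nu>r, folded m_def] by (elim exE conjE) (rule that)
  define J where "J t = C0 powr (t / m) * c powr (1 - t / m)" for t
  have J: "J t > 0" for t using C0 c_pos by (simp add: J_def)
  define K1 where "K1 = J (\<beta> + \<delta>) * (1 / \<beta> + 1 / \<delta>)"
  define K2 where "K2 = C0 powr (1 / r) * J (s * q) powr (1 / q) * (1 / (\<beta> - \<kappa> / r) + 1 / (\<nu> - \<beta> + s))"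
  have e: "\<beta> - \<kappa> / r > 0" "\<nu> - \<beta> + s > 0" using \<kappa> r \<nu> s by (auto simp: field_simps)
  have K: "K1 > 0" "K2 > 0"
    using J[of "\<beta> + \<delta>"] J[of "s * q"] C0 \<beta> \<delta> e by (auto simp: K1_def K2_def intro!: mult_pos_pos add_pos_pos)
  show ?thesis
  proof (intro exI[of _ "K1 powr (p - 1) * K2"] conjI ballI allI impI)
    show "K1 powr (p - 1) * K2 > 0" using K by simp
    fix w f g :: "'a \<Rightarrow> real" and A :: real
    assume [measurable]: "w \<in> borel_measurable borel" "f \<in> borel_measurable borel"
      and A: "A > 0"
      and "\<forall>x. 0 \<le> w x" "\<forall>x. 0 \<le> f x" "\<forall>x. 0 \<le> g x"
      and morrey: "\<forall>R>0. \<forall>x. ball_integral R x (\<lambda>y. ennreal (w y powr r)) \<le> ennreal (A powr r * R powr (Q - \<beta> * p * r))"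
      and g: "\<forall>x. ennreal (g x) \<le> potential \<beta> (\<lambda>y. ennreal (f y)) x"
    then have nonneg: "\<And>x. 0 \<le> w x" "\<And>x. 0 \<le> f x" "\<And>x. 0 \<le> g x"
      by auto
    \<comment> \<open>The weight is built from \<open>w powr r\<close>, with \<open>A powr r\<close>
      in the role of \<open>D\<close>.\<close>
    obtain h where [measurable]: "h \<in> borel_measurable borel" and h0: "\<And>x. 0 \<le> h x"
      and h: "AE x in lborel. h x > 0 \<and>
        (\<forall>R>0. ball_integral R x (\<lambda>y. ennreal (h y powr m))
              \<le> ennreal (C0 * (R powr Q * min (h x) (1 / R) powr m)) \<and>
            ball_integral R x (\<lambda>y. ennreal (w y powr r))
              \<le> ennreal (C0 * (A powr r * (R powr (Q - \<nu> * r) * min 1 ((R * h x) powr m)))))"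
    proof -
      have "(\<lambda>y. ennreal (w y powr r)) \<in> borel_measurable borel" "A powr r > 0"
        using A by simp_all
      from weight[rule_format, OF this morrey[rule_format, folded \<nu>_def]] that
      show thesis by blast
    qed
    have "(\<integral>\<^sup>+x. ennreal (w x * g x powr p) \<partial>lborel)
        \<le> ennreal (K1 powr (p - 1) * (K2 * A)) * (\<integral>\<^sup>+x. ennreal (f x powr p) \<partial>lborel)"
    proof (rule Schur_test[where \<beta> = \<beta> and \<phi> = "\<lambda>x. h x powr (\<beta> + \<delta>)" and \<psi> = "\<lambda>x. h x powr \<delta>"])
      show "AE x in lborel. 0 < h x powr (\<beta> + \<delta>) \<and> 0 < h x powr \<delta>"
        using h by eventually_elim simp
      show "AE x in lborel. potential \<beta> (\<lambda>y. ennreal (h y powr (\<beta> + \<delta>))) x \<le> ennreal (K1 * h x powr \<delta>)"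
        using h
      proof eventually_elim
        case (elim x)
        have "potential \<beta> (\<lambda>y. ennreal (h y powr (\<beta> + \<delta>))) x
            \<le> ennreal (J (\<beta> + \<delta>) * h x powr \<delta> * (1 / \<beta> + 1 / \<delta>))"
        proof (rule potential_le)
          fix R :: real assume R: "R > 0"
          have "ball_integral R x (\<lambda>y. ennreal (h y powr (\<beta> + \<delta>)))
              \<le> ennreal (J (\<beta> + \<delta>) * (R powr Q * min (h x) (1 / R) powr (\<beta> + \<delta>)))"
            unfolding J_def by (rule ball_integral_powr_le) (use elim R h0 \<beta> \<delta> \<delta>1 C0 in auto)
          then show "ball_integral R x (\<lambda>y. ennreal (h y powr (\<beta> + \<delta>))) \<le> ennreal (J (\<beta> + \<delta>) * h x powr \<delta> *
              (R powr (Q - \<beta>) * min ((R * h x) powr \<beta>) ((R * h x) powr - \<delta>)))"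
            using R elim \<beta> \<delta> by (simp only: min_inverse_powr mult.assoc)
        qed (use elim \<beta> \<delta> J[of "\<beta> + \<delta>"] in auto)
        then show ?case by (simp add: K1_def mult_ac)
      qed
      show "AE x in lborel. potential \<beta> (\<lambda>y. ennreal (w y * (h y powr \<delta>) powr (p - 1))) x
          \<le> ennreal (K2 * A * (h x powr (\<beta> + \<delta>)) powr (p - 1))"
        using h
      proof eventually_elim
        case (elim x)
        let ?K = "C0 powr (1 / r) * J (s * q) powr (1 / q)"
        have "potential \<beta> (\<lambda>y. ennreal (w y * h y powr s)) x
            \<le> ennreal (?K * A * h x powr (\<nu> - \<beta> + s) * (1 / (\<beta> - \<kappa> / r) + 1 / (\<nu> - \<beta> + s)))"
        proof (rule potential_le)
          fix R :: real assume R: "R > 0"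
          \<comment> \<open>Up to constants, \<open>?X\<close> is the bound for the integral of
            \<open>w powr r\<close> divided by \<open>A powr r\<close>, and \<open>?Y\<close> the
            bound for that of \<open>h powr (s * q)\<close>; Hoelder combines their roots of orders
            \<open>r\<close> and \<open>q\<close>.\<close>
          let ?X = "R powr (Q - \<nu> * r) * min 1 ((R * h x) powr m)"
          let ?Y = "R powr Q * min (h x) (1 / R) powr (s * q)"
          have XY: "?X \<ge> 0" "?Y \<ge> 0" by simp_all
          have "ball_integral R x (\<lambda>y. ennreal (w y * h y powr s))
            \<le> ennreal ((C0 * (A powr r * ?X)) powr (1 / r) * (J (s * q) * ?Y) powr (1 / q))"
            unfolding ball_integral_def
          proof (rule nn_integral_weighted_Holder)
            show "(\<integral>\<^sup>+y. indicator {..<R} (N (y - x)) * ennreal (w y powr r) \<partial>lborel) \<le> ennreal (C0 * (A powr r * ?X))"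
              using elim R by (simp add: ball_integral_def)
            have "ball_integral R x (\<lambda>y. ennreal (h y powr (s * q))) \<le> ennreal (J (s * q) * ?Y)"
              unfolding J_def by (rule ball_integral_powr_le) (use elim R h0 sq C0 in auto)
            then show "(\<integral>\<^sup>+y. indicator {..<R} (N (y - x)) * ennreal ((h y powr s) powr q) \<partial>lborel) \<le> ennreal (J (s * q) * ?Y)"
              by (simp add: ball_integral_def powr_powr)
          qed (use nonneg r q C0 A J[of "s * q"] XY in auto)
          also have "(C0 * (A powr r * ?X)) powr (1 / r) * (J (s * q) * ?Y) powr (1 / q)
              = ?K * A * (?X powr (1 / r) * ?Y powr (1 / q))"
          proof -
            have "(C0 * (A powr r * ?X)) powr (1 / r) = C0 powr (1 / r) * (A * ?X powr (1 / r))"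
              using C0 A XY r by (simp only: powr_mult less_imp_le mult_nonneg_nonneg powr_ge_zero powr_powr) simp
            moreover have "(J (s * q) * ?Y) powr (1 / q) = J (s * q) powr (1 / q) * ?Y powr (1 / q)"
              by (rule powr_mult)
            ultimately show ?thesis by simp
          qed
          also have "?X powr (1 / r) * ?Y powr (1 / q) = h x powr (\<nu> - \<beta> + s) *
              (R powr (Q - \<beta>) * min ((R * h x) powr (\<beta> - \<kappa> / r)) ((R * h x) powr - (\<nu> - \<beta> + s)))"
            unfolding m_def q_def by (rule Holder_bound_eq) (use R elim r \<kappa> s \<nu> in auto)
          finally show "ball_integral R x (\<lambda>y. ennreal (w y * h y powr s)) \<le> ennreal (?K * A * h x powr (\<nu> - \<beta> + s) *
              (R powr (Q - \<beta>) * min ((R * h x) powr (\<beta> - \<kappa> / r)) ((R * h x) powr - (\<nu> - \<beta> + s))))"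
            by (simp only: mult.assoc)
        qed (use elim e A C0 in auto)
        moreover have "?K * A * h x powr (\<nu> - \<beta> + s) * (1 / (\<beta> - \<kappa> / r) + 1 / (\<nu> - \<beta> + s))
            = K2 * A * h x powr (\<nu> - \<beta> + s)"
          by (simp add: K2_def)
        \<comment> \<open>Here \<open>\<nu> = \<beta> * p\<close> matters: it makes the power of
          \<open>h\<close> produced by the estimate equal to the power of \<phi> demanded by Schur's
          test.\<close>
        moreover have "(h x powr (\<beta> + \<delta>)) powr (p - 1) = h x powr (\<nu> - \<beta> + s)"
        proof -
          have "(\<beta> + \<delta>) * (p - 1) = \<nu> - \<beta> + s"
            by (simp add: \<nu>_def s_def algebra_simps)
          then show ?thesis by (simp only: powr_powr)
        qed
        moreover have "(h y powr \<delta>) powr (p - 1) = h y powr s" for y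
          by (simp add: powr_powr s_def)
        ultimately show ?case by simp
      qed
    qed (use p nonneg K A g in auto)
    then show "(\<integral>\<^sup>+x. ennreal (w x * g x powr p) \<partial>lborel)
        \<le> ennreal (K1 powr (p - 1) * K2 * A) * (\<integral>\<^sup>+x. ennreal (f x powr p) \<partial>lborel)"
      by (simp only: mult.assoc)
  qed
qed

end

section \<open>The parabolic setting\<close>

text \<open>Homogeneous of degree one under the dilations that multiply time by
  \<open>\<lambda> powr \<alpha>\<close> and space by \<lambda>. The maximum makes balls products of
  a time interval and a Euclidean ball, hence comparable to Morrey cylinders.\<close>

definition parabolic_norm :: "real \<Rightarrow> real \<times> (real ^ 'n) \<Rightarrow> real" where
  "parabolic_norm \<alpha> z = max (\<bar>fst z\<bar> powr (1 / \<alpha>)) (norm (snd z))"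

text \<open>For \<open>0 \<le> x \<le> 1\<close> one has \<open>x \<le> x powr s\<close>; this is
  applied to \<open>a / (a + b)\<close> and \<open>b / (a + b)\<close>, whose sum is
  \<open>1\<close>.\<close>

lemma powr_add_le:
  fixes a b s :: real
  assumes "a \<ge> 0" "b \<ge> 0" "0 < s" "s \<le> 1"
  shows "(a + b) powr s \<le> a powr s + b powr s"
proof (cases "a + b = 0")
  case False
  then have ab: "a + b > 0" using assms by simp
  have *: "x / (a + b) \<le> (x / (a + b)) powr s" if "0 \<le> x" "x \<le> a + b" for x
  proof (cases "x = 0")
    case False
    then show ?thesis using powr_mono'[of s 1 "x / (a + b)"] that assms ab by simp
  qed (use assms in simp)
  have "1 = a / (a + b) + b / (a + b)" using ab by (simp add: add_divide_distrib[symmetric])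
  also have "\<dots> \<le> (a / (a + b)) powr s + (b / (a + b)) powr s"
    using assms by (intro add_mono *) auto
  also have "\<dots> = (a powr s + b powr s) / (a + b) powr s"
    using assms ab by (simp add: powr_divide add_divide_distrib)
  finally show ?thesis using ab by (simp add: field_simps)
qed (use assms in \<open>auto simp: add_nonneg_eq_0_iff\<close>)

lemma emeasure_parabolic_cylinder_le:
  fixes z :: "real \<times> (real ^ 'n)"
  assumes "\<rho> > 0"
  shows "emeasure lborel (parabolic_cylinder \<alpha> \<rho> z)
    \<le> ennreal (2 ^ CARD('n) * \<rho> powr (real CARD('n) + \<alpha>))"
proof -
  obtain t x where z: "z = (t, x)" by fastforce
  let ?B = "cbox (\<chi> i. x $ i - \<rho>) (\<chi> i. x $ i + \<rho>)"
  \<comment> \<open>Enclosing the Euclidean ball in a cube of side \<open>2 * \<rho>\<close> yields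
    the explicit constant.\<close>
  have "parabolic_cylinder \<alpha> \<rho> z \<subseteq> {t..t + \<rho> powr \<alpha>} \<times> ?B"
  proof
    fix w assume "w \<in> parabolic_cylinder \<alpha> \<rho> z"
    then obtain s y where w: "w = (s, y)" "t \<le> s" "s \<le> t + \<rho> powr \<alpha>" "norm (y - x) \<le> \<rho>"
      by (auto simp: parabolic_cylinder_def z)
    have "\<bar>y $ i - x $ i\<bar> \<le> \<rho>" for i
      using component_le_norm_cart[of "y - x" i] w(4) by simp
    then have "x $ i - \<rho> \<le> y $ i \<and> y $ i \<le> x $ i + \<rho>" for i
      by (simp add: abs_le_iff algebra_simps)
    then show "w \<in> {t..t + \<rho> powr \<alpha>} \<times> ?B" using w by (auto simp: mem_box_cart)
  qed
  then have "emeasure lborel (parabolic_cylinder \<alpha> \<rho> z) \<le> emeasure (lborel \<Otimes>\<^sub>M lborel) ({t..t + \<rho> powr \<alpha>} \<times> ?B)"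
    unfolding lborel_prod by (intro emeasure_mono) (auto intro!: borel_closed closed_Times)
  also have "\<dots> = emeasure lborel {t..t + \<rho> powr \<alpha>} * emeasure lborel ?B"
    by (rule lborel.emeasure_pair_measure_Times) auto
  also have "emeasure lborel ?B = ennreal (\<Prod>b\<in>Basis. (((\<chi> i. x $ i + \<rho>) - (\<chi> i. x $ i - \<rho>)) \<bullet> b))"
    using assms by (subst emeasure_lborel_cbox) (auto simp: Basis_vec_def inner_axis)
  also have "(\<Prod>b\<in>Basis. (((\<chi> i. x $ i + \<rho>) - (\<chi> i. x $ i - \<rho>)) \<bullet> b)) = (\<Prod>b\<in>(Basis :: (real^'n) set). 2 * \<rho>)"
    by (intro prod.cong refl) (auto simp: Basis_vec_def inner_axis)
  also have "\<dots> = (2 * \<rho>) ^ CARD('n)" by simp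
  also have "emeasure lborel {t..t + \<rho> powr \<alpha>} * ennreal ((2 * \<rho>) ^ CARD('n))
      = ennreal (2 ^ CARD('n) * \<rho> powr (real CARD('n) + \<alpha>))"
    using assms by (simp add: ennreal_mult[symmetric] powr_add powr_realpow power_mult_distrib mult_ac)
  finally show ?thesis .
qed

lemma parabolic_cylinder_eq_Times: "parabolic_cylinder \<alpha> \<rho> (t, x) = {t..t + \<rho> powr \<alpha>} \<times> cball x \<rho>"
  by (auto simp: parabolic_cylinder_def dist_norm norm_minus_commute)

text \<open>Morrey cylinders extend forward in time only, hence the shift of the base point.\<close>

lemma parabolic_ball_subset_cylinder:
  assumes "R > 0" "\<alpha> \<ge> 1" "parabolic_norm \<alpha> (w - (t, x)) < R"
  shows "w \<in> parabolic_cylinder \<alpha> (2 * R) (t - R powr \<alpha>, x)"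
proof -
  obtain s y where w: "w = (s, y)" by fastforce
  have *: "\<bar>s - t\<bar> powr (1 / \<alpha>) < R" "norm (y - x) < R"
    using assms(3) by (auto simp: parabolic_norm_def w)
  have "(\<bar>s - t\<bar> powr (1 / \<alpha>)) powr \<alpha> < R powr \<alpha>"
    using * assms by (intro powr_less_mono2) auto
  then have "\<bar>s - t\<bar> < R powr \<alpha>" using assms by (simp add: powr_powr)
  \<comment> \<open>By \<open>\<alpha> \<ge> 1\<close>, the two-sided time interval of length
    \<open>2 * R powr \<alpha>\<close> fits into the forward interval of a cylinder of radius
    \<open>2 * R\<close>.\<close>
  moreover have "2 * R powr \<alpha> \<le> (2 * R) powr \<alpha>"
    using assms powr_mono[of 1 \<alpha> 2] by (simp add: powr_mult)
  ultimately show ?thesis using * assms by (auto simp: parabolic_cylinder_def w)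
qed

text \<open>The triangle inequality in time rests on \<open>1 / \<alpha> \<le> 1\<close>. The factor
  \<open>2 powr (real CARD('n) + \<alpha>)\<close> comes from enclosing a ball of radius
  \<open>R\<close> in a cylinder of radius \<open>2 * R\<close>.\<close>

lemma homogeneous_norm_parabolic:
  assumes \<alpha>: "\<alpha> > 1"
  shows "homogeneous_norm (parabolic_norm \<alpha> :: real \<times> (real ^ 'n) \<Rightarrow> real) (real CARD('n) + \<alpha>)
    (2 ^ CARD('n) * 2 powr (real CARD('n) + \<alpha>))"
proof
  have cont: "continuous_on UNIV (parabolic_norm \<alpha> :: real \<times> (real ^ 'n) \<Rightarrow> real)"
    unfolding parabolic_norm_def[abs_def] using \<alpha> by (intro continuous_intros continuous_on_powr') auto
  then show meas: "(parabolic_norm \<alpha> :: real \<times> (real ^ 'n) \<Rightarrow> real) \<in> borel_measurable borel"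
    by (rule borel_measurable_continuous_onI)
  fix x y :: "real \<times> (real ^ 'n)" and R :: real
  show "0 \<le> parabolic_norm \<alpha> x" "parabolic_norm \<alpha> (- x) = parabolic_norm \<alpha> x"
    by (simp_all add: parabolic_norm_def le_max_iff_disj)
  have "\<bar>fst (x + y)\<bar> powr (1 / \<alpha>) \<le> (\<bar>fst x\<bar> + \<bar>fst y\<bar>) powr (1 / \<alpha>)"
    using \<alpha> by (intro powr_mono2) auto
  also have "\<dots> \<le> \<bar>fst x\<bar> powr (1 / \<alpha>) + \<bar>fst y\<bar> powr (1 / \<alpha>)"
    using \<alpha> by (intro powr_add_le) auto
  finally show "parabolic_norm \<alpha> (x + y) \<le> parabolic_norm \<alpha> x + parabolic_norm \<alpha> y"
    using norm_triangle_ineq[of "snd x" "snd y"] by (auto simp: parabolic_norm_def)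
  show "emeasure lborel {x :: real \<times> (real ^ 'n). parabolic_norm \<alpha> x < 1} > 0"
  proof -
    have "open {x :: real \<times> (real ^ 'n). parabolic_norm \<alpha> x < 1}"
      using cont by (intro open_Collect_less) auto
    moreover have "0 \<in> {x :: real \<times> (real ^ 'n). parabolic_norm \<alpha> x < 1}"
      using \<alpha> by (simp add: parabolic_norm_def)
    ultimately have "\<not> negligible {x :: real \<times> (real ^ 'n). parabolic_norm \<alpha> x < 1}"
      by (intro open_not_negligible) blast+
    then show ?thesis
      using meas by (auto simp: negligible_iff_emeasure0 zero_less_iff_neq_zero)
  qed
  show "emeasure lborel {x :: real \<times> (real ^ 'n). parabolic_norm \<alpha> x < R}
      \<le> ennreal (2 ^ CARD('n) * 2 powr (real CARD('n) + \<alpha>) * R powr (real CARD('n) + \<alpha>))" if R: "R > 0"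
  proof -
    have "emeasure lborel {x :: real \<times> (real ^ 'n). parabolic_norm \<alpha> x < R}
        \<le> emeasure lborel (parabolic_cylinder \<alpha> (2 * R) (0 - R powr \<alpha>, 0 :: real ^ 'n))"
      using parabolic_ball_subset_cylinder[OF R, of \<alpha> _ 0 0] \<alpha>
      by (intro emeasure_mono) (auto simp: parabolic_cylinder_eq_Times zero_prod_def[symmetric] intro!: borel_closed closed_Times)
    also have "\<dots> \<le> ennreal (2 ^ CARD('n) * (2 * R) powr (real CARD('n) + \<alpha>))"
      using R by (intro emeasure_parabolic_cylinder_le) auto
    finally show ?thesis using R by (simp add: powr_mult mult.assoc)
  qed
qed (use \<alpha> in auto)

section \<open>Domination of both operators by the parabolic potential\<close>

lemma p_kernel_le:
  fixes y :: "real ^ 'n"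
  assumes \<alpha>: "\<alpha> > 1" and \<gamma>: "\<gamma> \<ge> 0" and s: "s > 0"
  shows "p_kernel \<alpha> \<gamma> s y \<le> parabolic_norm \<alpha> (s, y) powr (\<alpha> * \<gamma> / 2 - (real CARD('n) + \<alpha>))"
proof (cases "norm y \<ge> s powr (1 / \<alpha>)")
  case True
  then have y: "norm y > 0" using s by (smt (verit) powr_gt_zero)
  \<comment> \<open>The two branches of the kernel are the two cases of the maximum in the norm. In
    this one the time factor is traded for a power of \<open>norm y\<close>; in the other one the
    kernel is exactly the power of the norm.\<close>
  have "s powr (\<gamma> / 2) = (s powr (1 / \<alpha>)) powr (\<alpha> * \<gamma> / 2)"
    using \<alpha> by (simp add: powr_powr)
  also have "\<dots> \<le> norm y powr (\<alpha> * \<gamma> / 2)"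
    using True \<alpha> \<gamma> by (intro powr_mono2) auto
  finally have "p_kernel \<alpha> \<gamma> s y \<le> norm y powr (\<alpha> * \<gamma> / 2) * norm y powr (- real CARD('n) - \<alpha>)"
    using True s by (simp add: p_kernel_def mult_right_mono)
  also have "\<dots> = norm y powr (\<alpha> * \<gamma> / 2 + (- real CARD('n) - \<alpha>))"
    by (rule powr_add[symmetric])
  also have "\<alpha> * \<gamma> / 2 + (- real CARD('n) - \<alpha>) = \<alpha> * \<gamma> / 2 - (real CARD('n) + \<alpha>)"
    by simp
  finally show ?thesis using True s by (simp add: parabolic_norm_def max_absorb2)
next
  case False
  have "\<gamma> / 2 - (real CARD('n) + \<alpha>) / \<alpha> = 1 / \<alpha> * (\<alpha> * \<gamma> / 2 - (real CARD('n) + \<alpha>))"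
    using \<alpha> by (simp add: field_simps)
  then show ?thesis using False s
    by (simp add: p_kernel_def parabolic_norm_def max_absorb1 powr_powr)
qed

text \<open>The adjoint operator runs backwards in time; since the parabolic norm is even in time,
  this reflection brings it to the same potential.\<close>

lemma nn_integral_lborel_reflect_time:
  fixes F :: "real \<times> 'a::euclidean_space \<Rightarrow> ennreal"
  assumes [measurable]: "F \<in> borel_measurable borel"
  shows "(\<integral>\<^sup>+z. F (- fst z, snd z) \<partial>lborel) = (\<integral>\<^sup>+z. F z \<partial>lborel)"
proof -
  have [measurable]: "F \<in> borel_measurable (lborel \<Otimes>\<^sub>M lborel)" by (simp add: lborel_prod)
  have "(\<integral>\<^sup>+z. F (- fst z, snd z) \<partial>lborel) = (\<integral>\<^sup>+z. F (- fst z, snd z) \<partial>(lborel \<Otimes>\<^sub>M lborel))"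
    by (simp add: lborel_prod)
  also have "\<dots> = (\<integral>\<^sup>+y. \<integral>\<^sup>+s. F (- s, y) \<partial>lborel \<partial>lborel)"
    by (subst lborel_pair.nn_integral_snd[symmetric]) auto
  also have "\<dots> = (\<integral>\<^sup>+y. \<integral>\<^sup>+s. F (s, y) \<partial>lborel \<partial>lborel)"
  proof (rule nn_integral_cong)
    fix y
    have "(\<lambda>s. F (s, y)) \<in> borel_measurable borel" by measurable
    from nn_integral_real_affine[OF this, of "-1" 0]
    show "(\<integral>\<^sup>+s. F (- s, y) \<partial>lborel) = (\<integral>\<^sup>+s. F (s, y) \<partial>lborel)" by simp
  qed
  also have "\<dots> = (\<integral>\<^sup>+z. F z \<partial>(lborel \<Otimes>\<^sub>M lborel))"
    by (subst lborel_pair.nn_integral_snd[symmetric]) auto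
  finally show ?thesis by (simp add: lborel_prod)
qed

text \<open>Without integrability the Bochner integral is \<open>0\<close>, so the bound holds for
  every function and applies directly to the operators.\<close>

lemma ennreal_abs_integral_le:
  fixes f :: "'a \<Rightarrow> real"
  shows "ennreal \<bar>integral\<^sup>L M f\<bar> \<le> (\<integral>\<^sup>+x. ennreal \<bar>f x\<bar> \<partial>M)"
  using integral_norm_bound_ennreal[of M f] by (cases "integrable M f") (auto simp: not_integrable_integral_eq)

text \<open>By \<open>kern_eq\<close>, the kernel of the potential carries
  \<open>1 / (Q - \<beta>)\<close>; the factor \<open>Q - \<beta>\<close> placed on \<open>f\<close>
  compensates for it.\<close>

lemma
  fixes f :: "real \<times> (real ^ 'n) \<Rightarrow> real"
  assumes \<alpha>: "\<alpha> > 1" and \<gamma>: "\<gamma> \<ge> 0" and \<beta>: "\<beta> = \<alpha> * \<gamma> / 2" and Q: "Q = real CARD('n) + \<alpha>" and "\<beta> < Q"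
    and f [measurable]: "f \<in> borel_measurable borel"
  shows P_op_le_potential: "ennreal \<bar>P_op \<alpha> \<gamma> f z\<bar>
      \<le> homogeneous_norm.potential (parabolic_norm \<alpha>) Q \<beta> (\<lambda>y. ennreal ((Q - \<beta>) * \<bar>f y\<bar>)) z"
    and P_adj_op_le_potential: "ennreal \<bar>P_adj_op \<alpha> \<gamma> f z\<bar>
      \<le> homogeneous_norm.potential (parabolic_norm \<alpha>) Q \<beta> (\<lambda>y. ennreal ((Q - \<beta>) * \<bar>f y\<bar>)) z"
proof -
  let ?N = "parabolic_norm \<alpha> :: real \<times> (real ^ 'n) \<Rightarrow> real"
  interpret homogeneous_norm ?N Q "2 ^ CARD('n) * 2 powr (real CARD('n) + \<alpha>)"
    unfolding Q by (rule homogeneous_norm_parabolic[OF \<alpha>])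
  let ?g = "\<lambda>y. ennreal ((Q - \<beta>) * \<bar>f y\<bar>)"
  obtain t x where z: "z = (t, x)" by fastforce
  \<comment> \<open>For positive times the norm is positive and \<open>kern_eq\<close> applies; at
    all other times \<open>p_kernel\<close> vanishes.\<close>
  have kernel: "ennreal \<bar>p_kernel \<alpha> \<gamma> (fst w) (snd w) * a\<bar> \<le> kern \<beta> (?N w) * ennreal ((Q - \<beta>) * \<bar>a\<bar>)" for w :: "real \<times> (real ^ 'n)" and a
  proof (cases "fst w > 0")
    case True
    have N: "?N w > 0" using True by (auto simp: parabolic_norm_def less_max_iff_disj)
    have "0 \<le> p_kernel \<alpha> \<gamma> (fst w) (snd w)" by (simp add: p_kernel_def)
    moreover have "p_kernel \<alpha> \<gamma> (fst w) (snd w) \<le> ?N w powr (\<beta> - Q)"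
      using p_kernel_le[OF \<alpha> \<gamma> True, of "snd w"] by (simp add: \<beta> Q)
    ultimately have "\<bar>p_kernel \<alpha> \<gamma> (fst w) (snd w) * a\<bar> \<le> ?N w powr (\<beta> - Q) * \<bar>a\<bar>"
      by (simp add: abs_mult mult_right_mono)
    also have "\<dots> = ?N w powr (\<beta> - Q) / (Q - \<beta>) * ((Q - \<beta>) * \<bar>a\<bar>)"
      using \<open>\<beta> < Q\<close> by simp
    finally show ?thesis
      using \<open>\<beta> < Q\<close> by (simp only: kern_eq[OF N \<open>\<beta> < Q\<close>]) (subst ennreal_mult[symmetric]; simp add: ennreal_leI)
  qed (simp add: p_kernel_def)
  have pot: "potential \<beta> ?g z = (\<integral>\<^sup>+w. kern \<beta> (?N w) * ?g (z + w) \<partial>lborel)"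
    using nn_integral_lborel_shift[of "\<lambda>y. kern \<beta> (?N (y - z)) * ?g y" z] by (simp add: potential_eq_kern)
  have "ennreal \<bar>P_op \<alpha> \<gamma> f z\<bar> \<le> (\<integral>\<^sup>+w. ennreal \<bar>p_kernel \<alpha> \<gamma> (fst w) (snd w) * f (z + w)\<bar> \<partial>lborel)"
    using ennreal_abs_integral_le[of lebesgue "\<lambda>(s, y). p_kernel \<alpha> \<gamma> s y * f (t + s, x + y)"]
    by (simp add: P_op_def z nn_integral_completion case_prod_unfold plus_prod_def)
  also have "\<dots> \<le> potential \<beta> ?g z"
    unfolding pot by (intro nn_integral_mono kernel)
  finally show "ennreal \<bar>P_op \<alpha> \<gamma> f z\<bar> \<le> potential \<beta> ?g z" .
  have "ennreal \<bar>P_adj_op \<alpha> \<gamma> f z\<bar>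
      \<le> (\<integral>\<^sup>+w. ennreal \<bar>p_kernel \<alpha> \<gamma> (fst w) (snd w) * f (z + (- fst w, snd w))\<bar> \<partial>lborel)"
    using ennreal_abs_integral_le[of lebesgue "\<lambda>(s, y). p_kernel \<alpha> \<gamma> s y * f (t - s, x + y)"]
    by (simp add: P_adj_op_def z nn_integral_completion case_prod_unfold plus_prod_def)
  also have "\<dots> \<le> (\<integral>\<^sup>+w. kern \<beta> (?N w) * ?g (z + (- fst w, snd w)) \<partial>lborel)"
    by (intro nn_integral_mono kernel)
  also have "\<dots> = (\<integral>\<^sup>+w. kern \<beta> (?N (- fst w, snd w)) * ?g (z + (- fst w, snd w)) \<partial>lborel)"
    by (simp add: parabolic_norm_def)
  also have "\<dots> = potential \<beta> ?g z"
    unfolding pot by (rule nn_integral_lborel_reflect_time) measurable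
  finally show "ennreal \<bar>P_adj_op \<alpha> \<gamma> f z\<bar> \<le> potential \<beta> ?g z" .
qed

section \<open>From Morrey norms and compact support to integral bounds\<close>

lemma morrey_ball_bound:
  fixes v :: "real \<times> (real ^ 'n) \<Rightarrow> real"
  assumes \<alpha>: "\<alpha> > 1" and q: "q > 1" and v: "v \<in> morrey_class \<alpha> q" and R: "R > 0"
    and M: "enn2real (morrey_norm \<alpha> q v) \<le> M"
  shows "(\<integral>\<^sup>+w. indicator {..<R} (parabolic_norm \<alpha> (w - z)) * ennreal (\<bar>v w\<bar> powr q) \<partial>lebesgue)
    \<le> ennreal (2 ^ CARD('n) * 2 powr (real CARD('n) + \<alpha> - q) * M powr q * R powr (real CARD('n) + \<alpha> - q))"
proof -
  obtain t x where z: "z = (t, x)" by fastforce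
  define \<rho> where "\<rho> = 2 * R"
  have \<rho>: "\<rho> > 0" using R by (simp add: \<rho>_def)
  define C where "C = parabolic_cylinder \<alpha> \<rho> (t - R powr \<alpha>, x)"
  have "compact C" unfolding C_def parabolic_cylinder_eq_Times by (intro compact_Times) auto
  then have C [measurable]: "C \<in> sets lborel" by (simp add: borel_compact)
  have M0: "M \<ge> 0" using M enn2real_nonneg[of "morrey_norm \<alpha> q v"] by linarith
  have vol: "emeasure lebesgue C = ennreal (measure lebesgue C)"
    using emeasure_compact_finite[OF \<open>compact C\<close>] C by (simp add: emeasure_eq_ennreal_measure)
  let ?I = "LINT w:C|lebesgue. \<bar>v w\<bar> powr q"
  have I0: "?I \<ge> 0" by (simp add: set_lebesgue_integral_def integral_nonneg)
  have nn_eq: "(\<integral>\<^sup>+w. indicator C w * ennreal (\<bar>v w\<bar> powr q) \<partial>lebesgue) = ennreal ?I"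
  proof -
    have "integrable lebesgue (\<lambda>w. indicator C w *\<^sub>R \<bar>v w\<bar> powr q)"
      using v \<open>compact C\<close> by (simp add: morrey_class_def Lq_loc_def set_integrable_def)
    then have "(\<integral>\<^sup>+w. ennreal (indicator C w *\<^sub>R \<bar>v w\<bar> powr q) \<partial>lebesgue) = ennreal ?I"
      unfolding set_lebesgue_integral_def by (intro nn_integral_eq_integral) auto
    moreover have "ennreal (indicator C w *\<^sub>R \<bar>v w\<bar> powr q) = indicator C w * ennreal (\<bar>v w\<bar> powr q)" for w
      by (simp add: indicator_def)
    ultimately show ?thesis by simp
  qed
  have "?I \<le> measure lebesgue C * (M / \<rho>) powr q"
  proof (cases "measure lebesgue C = 0")
    \<comment> \<open>Here the average in the Morrey norm is formed with \<open>1 / 0 = 0\<close>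
      and carries no information, but the integral over a null set vanishes anyway.\<close>
    case True
    then have "C \<in> null_sets lebesgue" using vol C by (simp add: null_sets_def)
    then have "AE w in lebesgue. w \<notin> C" by (rule AE_not_in)
    then have "AE w in lebesgue. indicator C w * ennreal (\<bar>v w\<bar> powr q) = 0"
      by eventually_elim simp
    from nn_integral_cong_AE[OF this] show ?thesis using nn_eq True I0 by simp
  next
    case False
    then have C0: "measure lebesgue C > 0" by (simp add: zero_less_measure_iff)
    have "ennreal (\<rho> * (1 / measure lebesgue C * ?I) powr (1 / q)) \<le> morrey_norm \<alpha> q v"
      unfolding morrey_norm_def C_def using \<rho> by (intro SUP_upper2[of \<rho>] SUP_upper) auto
    moreover have "morrey_norm \<alpha> q v = ennreal (enn2real (morrey_norm \<alpha> q v))"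
      using v by (simp add: morrey_class_def)
    ultimately have "\<rho> * (1 / measure lebesgue C * ?I) powr (1 / q) \<le> enn2real (morrey_norm \<alpha> q v)"
      by (metis ennreal_le_iff enn2real_nonneg)
    with M have "\<rho> * (1 / measure lebesgue C * ?I) powr (1 / q) \<le> M"
      by (rule order_trans[rotated])
    then have "(1 / measure lebesgue C * ?I) powr (1 / q) \<le> M / \<rho>"
      using \<rho> by (simp add: field_simps)
    then have "((1 / measure lebesgue C * ?I) powr (1 / q)) powr q \<le> (M / \<rho>) powr q"
      using q by (intro powr_mono2) auto
    then show ?thesis using q C0 I0 by (simp add: powr_powr field_simps)
  qed
  also have "\<dots> \<le> 2 ^ CARD('n) * \<rho> powr (real CARD('n) + \<alpha>) * (M / \<rho>) powr q"
  proof (intro mult_right_mono)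
    have "ennreal (measure lebesgue C) \<le> ennreal (2 ^ CARD('n) * \<rho> powr (real CARD('n) + \<alpha>))"
      unfolding vol[symmetric] using emeasure_parabolic_cylinder_le[OF \<rho>, of \<alpha> "(t - R powr \<alpha>, x)"] C by (simp add: C_def)
    then show "measure lebesgue C \<le> 2 ^ CARD('n) * \<rho> powr (real CARD('n) + \<alpha>)"
      by (subst (asm) ennreal_le_iff) auto
  qed simp
  also have "\<dots> = 2 ^ CARD('n) * 2 powr (real CARD('n) + \<alpha> - q) * M powr q * R powr (real CARD('n) + \<alpha> - q)"
    using R M0 by (simp add: \<rho>_def powr_divide powr_diff powr_mult)
  finally have I: "?I \<le> \<dots>" .
  have "(\<integral>\<^sup>+w. indicator {..<R} (parabolic_norm \<alpha> (w - z)) * ennreal (\<bar>v w\<bar> powr q) \<partial>lebesgue)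
      \<le> (\<integral>\<^sup>+w. indicator C w * ennreal (\<bar>v w\<bar> powr q) \<partial>lebesgue)"
    using parabolic_ball_subset_cylinder[OF R, of \<alpha> _ t x] \<alpha>
    by (intro nn_integral_mono mult_right_mono) (auto simp: indicator_def C_def \<rho>_def z)
  then show ?thesis using I unfolding nn_eq by (elim order_trans) (rule ennreal_leI)
qed

lemma nn_integral_powr_eq_Lp_norm:
  fixes f :: "'a::euclidean_space \<Rightarrow> real"
  assumes f: "f \<in> C_c" and p: "p > 0"
  shows "(\<integral>\<^sup>+z. ennreal (\<bar>f z\<bar> powr p) \<partial>lborel) = ennreal (Lp_norm p f powr p)"
proof -
  let ?S = "closure {z. f z \<noteq> 0}"
  have cont: "continuous_on UNIV (\<lambda>z. \<bar>f z\<bar> powr p)"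
    using f p by (intro continuous_on_powr' continuous_intros) (auto simp: C_c_def)
  then have "integrable lborel (\<lambda>z. indicator ?S z *\<^sub>R \<bar>f z\<bar> powr p)"
    using f by (intro borel_integrable_compact continuous_on_subset[OF cont]) (auto simp: C_c_def)
  moreover have "(\<lambda>z. indicator ?S z *\<^sub>R \<bar>f z\<bar> powr p) = (\<lambda>z. \<bar>f z\<bar> powr p)"
    using closure_subset[of "{z. f z \<noteq> 0}"] by (intro ext) (auto simp: indicator_def)
  ultimately have "integrable lborel (\<lambda>z. \<bar>f z\<bar> powr p)" by (simp only:)
  then have "integrable lebesgue (\<lambda>z. \<bar>f z\<bar> powr p)" by (simp add: integrable_completion)
  then have "(\<integral>\<^sup>+z. ennreal (\<bar>f z\<bar> powr p) \<partial>lebesgue) = ennreal (LINT z|lebesgue. \<bar>f z\<bar> powr p)"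
    by (intro nn_integral_eq_integral) auto
  then show ?thesis
    using p by (simp add: Lp_norm_def powr_powr nn_integral_completion integral_nonneg)
qed

theorem proposition1:
  fixes \<alpha> q p :: real
  assumes "CARD('n::finite) \<ge> 2"
    and "1 < \<alpha>" and "\<alpha> < 2"
    and "1 < q" and "q < real CARD('n) + \<alpha>"
    and "1 < p"
  shows "\<exists>C>0. \<forall>(b :: real \<times> (real ^ 'n) \<Rightarrow> real ^ 'n) \<in> borel_measurable lebesgue.
    (\<lambda>z. norm (b z) powr (1 / (\<alpha> - 1))) \<in> morrey_class \<alpha> q \<longrightarrow>
    (\<forall>f \<in> C_c.
      (\<integral>\<^sup>+ z. ennreal (norm (b z) * \<bar>P_op \<alpha> ((1 - 1 / \<alpha>) * (2 / p)) f z\<bar> powr p) \<partial>lebesgue)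
        \<le> ennreal (C powr p
            * enn2real (morrey_norm \<alpha> q (\<lambda>z. norm (b z) powr (1 / (\<alpha> - 1)))) powr (\<alpha> - 1)
            * Lp_norm p f powr p)
      \<and>
      (\<integral>\<^sup>+ z. ennreal (norm (b z) * \<bar>P_adj_op \<alpha> ((1 - 1 / \<alpha>) * (2 / p)) f z\<bar> powr p) \<partial>lebesgue)
        \<le> ennreal (C powr p
            * enn2real (morrey_norm \<alpha> q (\<lambda>z. norm (b z) powr (1 / (\<alpha> - 1)))) powr (\<alpha> - 1)
            * Lp_norm p f powr p))"
proof -
  define Q where "Q = real CARD('n) + \<alpha>"
  define \<beta> where "\<beta> = (\<alpha> - 1) / p"
  \<comment> \<open>Chosen so that \<open>w powr r\<close> is the \<open>q\<close>-th power of the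
    given Morrey function. Then \<open>\<beta> * p * r = q\<close>, which turns its Morrey bound
    into the hypothesis of the trace inequality; \<open>r > 1\<close> follows from
    \<open>q > 1 > \<alpha> - 1\<close>.\<close>
  define r where "r = q / (\<alpha> - 1)"
  define c where "c = 2 ^ CARD('n) * 2 powr (Q - q)"
  define K where "K = c powr (1 / r)"
  let ?N = "parabolic_norm \<alpha> :: real \<times> (real ^ 'n) \<Rightarrow> real"
  let ?\<gamma> = "(1 - 1 / \<alpha>) * (2 / p)"
  interpret homogeneous_norm ?N Q "2 ^ CARD('n) * 2 powr (real CARD('n) + \<alpha>)"
    unfolding Q_def by (rule homogeneous_norm_parabolic) (use assms in simp)
  have \<beta>: "\<beta> > 0" and \<gamma>: "?\<gamma> \<ge> 0" "\<beta> = \<alpha> * ?\<gamma> / 2"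
    using assms by (auto simp: \<beta>_def field_simps)
  have r: "r > 1" and \<beta>pr: "\<beta> * p * r = q" and qr: "(\<alpha> - 1) * r = q"
    using assms by (auto simp: r_def \<beta>_def field_simps)
  have "(\<alpha> - 1) * 1 < (\<alpha> - 1) * p" using assms by (intro mult_strict_left_mono) auto
  then have "\<beta> < \<alpha> - 1" using assms by (simp add: \<beta>_def divide_less_eq)
  then have \<beta>Q: "\<beta> < Q" by (simp add: Q_def)
  have c: "c > 0" and K: "K > 0" by (auto simp: c_def K_def)
  have qQ: "q \<le> Q" using assms by (simp add: Q_def)
  obtain C1 where C1: "C1 > 0" and trace: "\<forall>w\<in>borel_measurable borel. \<forall>f\<in>borel_measurable borel. \<forall>g. \<forall>A>0.
      (\<forall>x. 0 \<le> w x) \<longrightarrow> (\<forall>x. 0 \<le> f x) \<longrightarrow> (\<forall>x. 0 \<le> g x) \<longrightarrow>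
      (\<forall>R>0. \<forall>x. ball_integral R x (\<lambda>y. ennreal (w y powr r)) \<le> ennreal (A powr r * R powr (Q - q))) \<longrightarrow>
      (\<forall>x. ennreal (g x) \<le> potential \<beta> (\<lambda>y. ennreal (f y)) x) \<longrightarrow>
      (\<integral>\<^sup>+x. ennreal (w x * g x powr p) \<partial>lborel) \<le> ennreal (C1 * A) * (\<integral>\<^sup>+x. ennreal (f x powr p) \<partial>lborel)"
    using trace_inequality[OF \<beta> \<open>1 < p\<close> r, unfolded \<beta>pr, OF qQ] by (elim exE conjE) (rule that)
  \<comment> \<open>The statement contains \<open>C powr p\<close>, hence the root. \<open>K\<close>
    is the \<open>r\<close>-th root of the constant in the ball bound, and
    \<open>(Q - \<beta>) powr p\<close> stems from the factor placed on \<open>f\<close>.\<close>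
  define C where "C = (C1 * K * (Q - \<beta>) powr p) powr (1 / p)"
  have C: "C > 0" "C powr p = C1 * K * (Q - \<beta>) powr p"
    using C1 K \<beta>Q assms by (auto simp: C_def powr_powr)
  have bound: "(\<integral>\<^sup>+z. ennreal (norm (b z) * g z powr p) \<partial>lebesgue)
      \<le> ennreal (C powr p * enn2real (morrey_norm \<alpha> q (\<lambda>z. norm (b z) powr (1 / (\<alpha> - 1)))) powr (\<alpha> - 1)
            * Lp_norm p f powr p)"
    if b: "b \<in> borel_measurable lebesgue" "(\<lambda>z. norm (b z) powr (1 / (\<alpha> - 1))) \<in> morrey_class \<alpha> q"
      and f: "f \<in> C_c" and g: "\<And>z. 0 \<le> g z" "\<And>z. ennreal (g z) \<le> potential \<beta> (\<lambda>y. ennreal ((Q - \<beta>) * \<bar>f y\<bar>)) z"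
    for b :: "real \<times> (real ^ 'n) \<Rightarrow> real ^ 'n" and f g
  proof -
    let ?v = "\<lambda>z. norm (b z) powr (1 / (\<alpha> - 1))"
    define M where "M = enn2real (morrey_norm \<alpha> q ?v)"
    have M: "M \<ge> 0" by (simp add: M_def)
    have [measurable]: "f \<in> borel_measurable borel"
      using f by (auto simp: C_c_def intro: borel_measurable_continuous_onI)
    have "(\<lambda>z. norm (b z)) \<in> borel_measurable lebesgue" using b by measurable
    \<comment> \<open>The trace inequality works with Borel functions that are nonnegative
      everywhere: \<open>norm (b z)\<close> is replaced by a Borel representative and then by its
      absolute value, with a change on a null set only.\<close>
    then obtain w0 where [measurable]: "w0 \<in> borel_measurable lborel" and w0: "AE z in lborel. norm (b z) = w0 z"
      using completion_ex_borel_measurable_real by blast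
    define w where "w z = \<bar>w0 z\<bar>" for z
    have w_meas [measurable]: "w \<in> borel_measurable borel" unfolding w_def by measurable
    have w: "AE z in lborel. norm (b z) = w z"
      using w0 by eventually_elim (metis abs_norm_cancel w_def)
    have w_ball: "ball_integral R x (\<lambda>y. ennreal (w y powr r)) \<le> ennreal (c * L powr q * R powr (Q - q))"
      if "R > 0" "L \<ge> M" for R L x
    proof -
      have "(a powr (1 / (\<alpha> - 1))) powr q = a powr r" for a :: real by (simp add: powr_powr r_def)
      then have "ball_integral R x (\<lambda>y. ennreal (w y powr r))
          = (\<integral>\<^sup>+y. indicator {..<R} (?N (y - x)) * ennreal (\<bar>?v y\<bar> powr q) \<partial>lebesgue)"
        unfolding ball_integral_def nn_integral_completion
        by (intro nn_integral_cong_AE) (use w in eventually_elim, simp)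
      also have "\<dots> \<le> ennreal (c * L powr q * R powr (Q - q))"
        unfolding c_def Q_def by (rule morrey_ball_bound) (use that assms b in \<open>auto simp: M_def\<close>)
      finally show ?thesis .
    qed
    have f_int: "(\<integral>\<^sup>+z. ennreal (((Q - \<beta>) * \<bar>f z\<bar>) powr p) \<partial>lborel)
        = ennreal ((Q - \<beta>) powr p * Lp_norm p f powr p)"
      using \<beta>Q assms by (simp add: powr_mult ennreal_mult nn_integral_cmult nn_integral_powr_eq_Lp_norm[OF f])
    \<comment> \<open>The Morrey norm may vanish, whereas the trace inequality asks for
      \<open>A > 0\<close>. It is therefore applied with
      \<open>A = K * L powr (\<alpha> - 1)\<close> for \<open>L > M\<close>, where
      \<open>(\<alpha> - 1) * r = q\<close> gives \<open>A powr r = c * L powr q\<close>; afterwards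
      \<open>L\<close> tends to \<open>M\<close>.\<close>
    have le: "(\<integral>\<^sup>+z. ennreal (norm (b z) * g z powr p) \<partial>lebesgue)
        \<le> ennreal (C powr p * L powr (\<alpha> - 1) * Lp_norm p f powr p)" if L: "L > M" for L
    proof -
      have "(\<integral>\<^sup>+z. ennreal (norm (b z) * g z powr p) \<partial>lebesgue) = (\<integral>\<^sup>+z. ennreal (w z * g z powr p) \<partial>lborel)"
        unfolding nn_integral_completion by (intro nn_integral_cong_AE) (use w in eventually_elim, simp)
      also have "\<dots> \<le> ennreal (C1 * (K * L powr (\<alpha> - 1))) * (\<integral>\<^sup>+z. ennreal (((Q - \<beta>) * \<bar>f z\<bar>) powr p) \<partial>lborel)"
      proof (rule trace[rule_format])
        fix R x assume R: "R > (0::real)"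
        have "(K * L powr (\<alpha> - 1)) powr r = c * L powr q"
          using c K r by (simp add: powr_mult powr_powr qr K_def)
        then show "ball_integral R x (\<lambda>y. ennreal (w y powr r))
            \<le> ennreal ((K * L powr (\<alpha> - 1)) powr r * R powr (Q - q))"
          using w_ball[OF R] L by simp
      qed (use g L M K \<beta>Q in \<open>auto simp: w_def[abs_def]\<close>)
      also have "\<dots> = ennreal (C powr p * L powr (\<alpha> - 1) * Lp_norm p f powr p)"
        unfolding f_int C(2) using C1 K by (simp add: ennreal_mult[symmetric] mult_ac)
      finally show ?thesis .
    qed
    show ?thesis
    proof (rule LIMSEQ_le_const)
      have "(\<lambda>n. M + 1 / real (Suc n)) \<longlonglongrightarrow> M + 0"
        by (intro tendsto_intros LIMSEQ_Suc[OF lim_1_over_n])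
      then have "(\<lambda>n. (M + 1 / real (Suc n)) powr (\<alpha> - 1)) \<longlonglongrightarrow> M powr (\<alpha> - 1)"
        using M assms by (auto intro!: tendsto_powr' always_eventually)
      then show "(\<lambda>n. ennreal (C powr p * (M + 1 / real (Suc n)) powr (\<alpha> - 1) * Lp_norm p f powr p))
          \<longlonglongrightarrow> ennreal (C powr p * enn2real (morrey_norm \<alpha> q ?v) powr (\<alpha> - 1) * Lp_norm p f powr p)"
        unfolding M_def[symmetric] by (intro tendsto_ennrealI tendsto_mult tendsto_const)
      show "\<exists>N. \<forall>n\<ge>N. (\<integral>\<^sup>+z. ennreal (norm (b z) * g z powr p) \<partial>lebesgue)
          \<le> ennreal (C powr p * (M + 1 / real (Suc n)) powr (\<alpha> - 1) * Lp_norm p f powr p)"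
        by (intro exI allI impI le) simp
    qed
  qed
  show ?thesis
  proof (intro exI[of _ C] conjI ballI impI C(1))
    fix b :: "real \<times> (real ^ 'n) \<Rightarrow> real ^ 'n" and f :: "real \<times> (real ^ 'n) \<Rightarrow> real"
    assume b: "b \<in> borel_measurable lebesgue" "(\<lambda>z. norm (b z) powr (1 / (\<alpha> - 1))) \<in> morrey_class \<alpha> q"
      and f: "f \<in> C_c"
    have "f \<in> borel_measurable borel"
      using f by (auto simp: C_c_def intro: borel_measurable_continuous_onI)
    note le = P_op_le_potential[OF \<open>1 < \<alpha>\<close> \<gamma> Q_def \<beta>Q this] P_adj_op_le_potential[OF \<open>1 < \<alpha>\<close> \<gamma> Q_def \<beta>Q this]
    show "(\<integral>\<^sup>+ z. ennreal (norm (b z) * \<bar>P_op \<alpha> ?\<gamma> f z\<bar> powr p) \<partial>lebesgue)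
        \<le> ennreal (C powr p
            * enn2real (morrey_norm \<alpha> q (\<lambda>z. norm (b z) powr (1 / (\<alpha> - 1)))) powr (\<alpha> - 1)
            * Lp_norm p f powr p)"
      by (rule bound[OF b f _ le(1)]) simp
    show "(\<integral>\<^sup>+ z. ennreal (norm (b z) * \<bar>P_adj_op \<alpha> ?\<gamma> f z\<bar> powr p) \<partial>lebesgue)
        \<le> ennreal (C powr p
            * enn2real (morrey_norm \<alpha> q (\<lambda>z. norm (b z) powr (1 / (\<alpha> - 1)))) powr (\<alpha> - 1)
            * Lp_norm p f powr p)"
      by (rule bound[OF b f _ le(2)]) simp
  qed
qed

end
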